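(* Let $\Bbbk$ be a field of characteristic zero, let $R=\Bbbk[x_1,\ldots,x_n]$ with its standard grading and with $\mathfrak{S}_n$ acting by permuting the variables, and let $\mathfrak{m}=(x_1,\ldots,x_n)$. Let $I\subseteq R$ be a homogeneous $\mathfrak{S}_n$-stable complete intersection ideal. Assume that, as a graded $\mathfrak{S}_n$-representation, $I/\mathfrak{m}I$ is isomorphic to a direct sum of one alternating representation in degree $d$ and $m\geqslant 0$ trivial representations in degrees $c_1,\ldots,c_m$. Then the graded character of $R/I$ is $$\chi_{R/I}=\chi_R\left(\chi^{(n)}-\chi^{(1^n)}t^d\right)\prod_{i=1}^m(1-t^{c_i}).$$
   Context: The group $\mathfrak{S}_n$ acts on $R$ by $\Bbbk$-algebra automorphisms permuting the variables, $\sigma\cdot x_i=x_{\sigma(i)}$. An ideal of $R$ is called a complete intersection ideal if it is generated by a regular sequence. Let $\mathcal{C}$ be the commutative ring of $\Bbbk$-valued class functions on $\mathfrak{S}_n$ under pointwise addition and multiplication. For a graded $\mathfrak{S}_n$-representation $V=\bigoplus_{d\geqslant 0}V_d$ over $\Bbbk$ with finite-dimensional components, the graded character of $V$ is $\chi_V=\sum_{d}\chi_{V_d}t^d\in\mathcal{C}[[t]]$, where $\chi_{V_d}$ is the character of $V_d$. $\chi^{(n)}$ is the trivial character of $\mathfrak{S}_n$ (the identity of $\mathcal{C}$) and $\chi^{(1^n)}$ is the character of the alternating (sign) representation. $R$, $I/\mathfrak{m}I$ and $R/I$ carry the induced gradings and $\mathfrak{S}_n$-actions; the displayed equality is in $\mathcal{C}[[t]]$,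 and an empty product is $1$. A representation "in degree $c$" is a graded representation concentrated in degree $c$. *)

theory Defs
  imports
    Complex_Main
    "HOL-Library.Poly_Mapping"
    "HOL-Library.FuncSet"
    "HOL-Combinatorics.Permutations"
    "HOL-Combinatorics.Perm"
    "HOL-Computational_Algebra.Formal_Power_Series"
begin

section \<open>The polynomial ring, its grading and the action of the symmetric group\<close>

text \<open>
  The variables are indexed by a finite type \<open>'n\<close>, so that \<open>n = CARD('n)\<close> and the symmetric group
  is the type \<open>'n perm\<close>.  Exponent vectors are elements of \<open>'n \<Rightarrow>\<^sub>0 nat\<close>.
\<close>

type_synonym ('n, 'k) mpoly = "('n \<Rightarrow>\<^sub>0 nat) \<Rightarrow>\<^sub>0 'k"

definition Const :: "'k::comm_ring_1 \<Rightarrow> ('n, 'k) mpoly" where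
  "Const a = Poly_Mapping.single 0 a"

definition Var :: "'n \<Rightarrow> ('n, 'k::comm_ring_1) mpoly" where
  "Var i = Poly_Mapping.single (Poly_Mapping.single i 1) 1"

definition monom_degree :: "('n::finite \<Rightarrow>\<^sub>0 nat) \<Rightarrow> nat" where
  "monom_degree a = (\<Sum>i\<in>UNIV. Poly_Mapping.lookup a i)"

definition homogeneous_part :: "nat \<Rightarrow> ('n::finite, 'k::comm_ring_1) mpoly set" where
  "homogeneous_part e = {f. \<forall>a\<in>Poly_Mapping.keys f. monom_degree a = e}"

text \<open>The substitution \<open>x\<^sub>i \<mapsto> x\<^bsub>\<sigma> i\<^esub>\<close>.\<close>

definition poly_act :: "'n::finite perm \<Rightarrow> ('n, 'k::comm_ring_1) mpoly \<Rightarrow> ('n, 'k) mpoly" where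
  "poly_act \<sigma> f = (\<Sum>a\<in>Poly_Mapping.keys f.
     Const (Poly_Mapping.lookup f a) * (\<Prod>i\<in>UNIV. Var (Perm.apply \<sigma> i) ^ Poly_Mapping.lookup a i))"

section \<open>Ideals\<close>

text \<open>An ideal of a commutative ring is a submodule of the ring over itself.\<close>

definition ideal_gen :: "'a::comm_ring_1 set \<Rightarrow> 'a set" where
  "ideal_gen S = module.span (*) S"

definition ideal_mult :: "'a::comm_ring_1 set \<Rightarrow> 'a set \<Rightarrow> 'a set" where
  "ideal_mult I J = ideal_gen {a * b | a b. a \<in> I \<and> b \<in> J}"

text \<open>
  Each \<open>f\<^sub>i\<close> is a non-zero-divisor modulo \<open>(f\<^sub>0, \<dots>, f\<^bsub>i-1\<^esub>)\<close>, and the quotient by the whole sequence is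
  nonzero.  The empty sequence is regular on a nonzero ring.
\<close>

definition regular_sequence :: "'a::comm_ring_1 list \<Rightarrow> bool" where
  "regular_sequence fs \<longleftrightarrow>
     (\<forall>i<length fs. \<forall>g. g * fs ! i \<in> ideal_gen (set (take i fs)) \<longrightarrow> g \<in> ideal_gen (set (take i fs)))
     \<and> ideal_gen (set fs) \<noteq> UNIV"

definition complete_intersection_ideal :: "'a::comm_ring_1 set \<Rightarrow> bool" where
  "complete_intersection_ideal I \<longleftrightarrow> (\<exists>fs. regular_sequence fs \<and> I = ideal_gen (set fs))"

definition homogeneous_ideal :: "('n::finite, 'k::comm_ring_1) mpoly set \<Rightarrow> bool" where
  "homogeneous_ideal I \<longleftrightarrow> (\<exists>H \<subseteq> (\<Union>e. homogeneous_part e). I = ideal_gen H)"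

definition sym_stable :: "('n::finite, 'k::comm_ring_1) mpoly set \<Rightarrow> bool" where
  "sym_stable I \<longleftrightarrow> (\<forall>\<sigma>. \<forall>f\<in>I. poly_act \<sigma> f \<in> I)"

definition max_ideal :: "('n, 'k::comm_ring_1) mpoly set" where
  "max_ideal = ideal_gen (range Var)"

section \<open>Class functions on the symmetric group\<close>

typedef (overloaded) ('n, 'k) class_fun =
  "{f :: 'n perm \<Rightarrow> 'k. \<forall>\<sigma> \<tau>. f (\<tau> * \<sigma> * inverse \<tau>) = f \<sigma>}"
  morphisms class_fun_apply Class_fun
  by (rule exI[of _ "\<lambda>_. undefined"]) simp

setup_lifting type_definition_class_fun

instantiation class_fun :: (type, comm_ring_1) comm_ring_1
begin

lift_definition zero_class_fun :: "('a, 'b) class_fun" is "\<lambda>_. 0" by simp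
lift_definition one_class_fun :: "('a, 'b) class_fun" is "\<lambda>_. 1" by simp
lift_definition plus_class_fun :: "('a, 'b) class_fun \<Rightarrow> ('a, 'b) class_fun \<Rightarrow> ('a, 'b) class_fun"
  is "\<lambda>f g \<sigma>. f \<sigma> + g \<sigma>" by simp
lift_definition minus_class_fun :: "('a, 'b) class_fun \<Rightarrow> ('a, 'b) class_fun \<Rightarrow> ('a, 'b) class_fun"
  is "\<lambda>f g \<sigma>. f \<sigma> - g \<sigma>" by simp
lift_definition uminus_class_fun :: "('a, 'b) class_fun \<Rightarrow> ('a, 'b) class_fun"
  is "\<lambda>f \<sigma>. - f \<sigma>" by simp
lift_definition times_class_fun :: "('a, 'b) class_fun \<Rightarrow> ('a, 'b) class_fun \<Rightarrow> ('a, 'b) class_fun"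
  is "\<lambda>f g \<sigma>. f \<sigma> * g \<sigma>" by simp

instance
  by standard (transfer; auto simp: fun_eq_iff algebra_simps)+

end

lift_definition trivial_char :: "('n, 'k::comm_ring_1) class_fun" is "\<lambda>_. 1"
  by simp

lift_definition alternating_char :: "('n, 'k::comm_ring_1) class_fun"
  is "\<lambda>\<sigma>. of_int (sign (Perm.apply \<sigma>))"
proof -
  fix \<sigma> \<tau> :: "'n perm"
  have perm: "permutation (Perm.apply \<rho>)" for \<rho> :: "'n perm"
    using Perm.apply[of \<rho>] by (simp add: permutation)
  show "of_int (sign (Perm.apply (\<tau> * \<sigma> * inverse \<tau>))) = of_int (sign (Perm.apply \<sigma>))"
    by (simp add: times_perm.rep_eq inverse_perm.rep_eq sign_compose sign_inverse perm
          permutation_compose permutation_inverse) (simp add: sign_def)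
qed

section \<open>Graded representations of the symmetric group\<close>

text \<open>
  A graded representation is given by its underlying set with the vector space operations over
  \<open>'k\<close>, the group action, and its homogeneous components.  This is raw data: the axioms hold
  for each of the representations constructed below, under the evident stability conditions.
\<close>

record ('n, 'k, 'v) graded_rep =
  rep_space :: "'v set"
  rep_add :: "'v \<Rightarrow> 'v \<Rightarrow> 'v"
  rep_zero :: 'v
  rep_scale :: "'k \<Rightarrow> 'v \<Rightarrow> 'v"
  rep_act :: "'n perm \<Rightarrow> 'v \<Rightarrow> 'v"
  rep_component :: "nat \<Rightarrow> 'v set"

definition graded_rep_iso ::
    "('n, 'k, 'v) graded_rep \<Rightarrow> ('n, 'k, 'w) graded_rep \<Rightarrow> bool" where
  "graded_rep_iso V W \<longleftrightarrow> (\<exists>\<phi>. bij_betw \<phi> (rep_space V) (rep_space W)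
     \<and> (\<forall>u\<in>rep_space V. \<forall>v\<in>rep_space V. \<phi> (rep_add V u v) = rep_add W (\<phi> u) (\<phi> v))
     \<and> (\<forall>a. \<forall>v\<in>rep_space V. \<phi> (rep_scale V a v) = rep_scale W a (\<phi> v))
     \<and> (\<forall>\<sigma>. \<forall>v\<in>rep_space V. \<phi> (rep_act V \<sigma> v) = rep_act W \<sigma> (\<phi> v))
     \<and> (\<forall>e. \<phi> ` rep_component V e = rep_component W e))"

subsection \<open>Constructions\<close>

definition poly_rep :: "('n::finite, 'k::field, ('n, 'k) mpoly) graded_rep" where
  "poly_rep = \<lparr> rep_space = UNIV, rep_add = (+), rep_zero = 0, rep_scale = (\<lambda>a f. Const a * f),
     rep_act = poly_act, rep_component = homogeneous_part \<rparr>"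

definition subrep :: "('n, 'k, 'v) graded_rep \<Rightarrow> 'v set \<Rightarrow> ('n, 'k, 'v) graded_rep" where
  "subrep V U = V \<lparr> rep_space := U, rep_component := (\<lambda>e. rep_component V e \<inter> U) \<rparr>"

definition rep_coset :: "('n, 'k, 'v) graded_rep \<Rightarrow> 'v set \<Rightarrow> 'v \<Rightarrow> 'v set" where
  "rep_coset V W v = rep_add V v ` W"

text \<open>
  In \<open>rep_scale\<close>, the set \<open>{a v | v \<in> A}\<close> alone would not be a coset of \<open>W\<close> for \<open>a = 0\<close>.
\<close>

definition quotient_rep :: "('n, 'k, 'v) graded_rep \<Rightarrow> 'v set \<Rightarrow> ('n, 'k, 'v set) graded_rep" where
  "quotient_rep V W = \<lparr>
     rep_space = rep_coset V W ` rep_space V,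
     rep_add = (\<lambda>A B. {rep_add V u v | u v. u \<in> A \<and> v \<in> B}),
     rep_zero = W,
     rep_scale = (\<lambda>a A. \<Union>v\<in>A. rep_coset V W (rep_scale V a v)),
     rep_act = (\<lambda>\<sigma> A. rep_act V \<sigma> ` A),
     rep_component = (\<lambda>e. rep_coset V W ` rep_component V e) \<rparr>"

definition one_dim_rep :: "('n, 'k::field) class_fun \<Rightarrow> nat \<Rightarrow> ('n, 'k, 'k) graded_rep" where
  "one_dim_rep \<chi> c = \<lparr> rep_space = UNIV, rep_add = (+), rep_zero = 0, rep_scale = (*),
     rep_act = (\<lambda>\<sigma> v. class_fun_apply \<chi> \<sigma> * v),
     rep_component = (\<lambda>e. if e = c then UNIV else {0}) \<rparr>"

definition trivial_rep :: "nat \<Rightarrow> ('n, 'k::field, 'k) graded_rep" where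
  "trivial_rep c = one_dim_rep trivial_char c"

definition alternating_rep :: "nat \<Rightarrow> ('n, 'k::field, 'k) graded_rep" where
  "alternating_rep c = one_dim_rep alternating_char c"

definition sum_rep ::
    "('n, 'k, 'v) graded_rep \<Rightarrow> ('n, 'k, 'w) graded_rep \<Rightarrow> ('n, 'k, 'v \<times> 'w) graded_rep" where
  "sum_rep V W = \<lparr>
     rep_space = rep_space V \<times> rep_space W,
     rep_add = (\<lambda>(u, w) (u', w'). (rep_add V u u', rep_add W w w')),
     rep_zero = (rep_zero V, rep_zero W),
     rep_scale = (\<lambda>a (u, w). (rep_scale V a u, rep_scale W a w)),
     rep_act = (\<lambda>\<sigma> (u, w). (rep_act V \<sigma> u, rep_act W \<sigma> w)),
     rep_component = (\<lambda>e. rep_component V e \<times> rep_component W e) \<rparr>"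

text \<open>
  The external direct sum of a family indexed by a finite set \<open>A\<close>, realised on the extensional
  product; for empty \<open>A\<close> this is the zero representation.
\<close>

definition direct_sum_rep ::
    "'i set \<Rightarrow> ('i \<Rightarrow> ('n, 'k, 'v) graded_rep) \<Rightarrow> ('n, 'k, 'i \<Rightarrow> 'v) graded_rep" where
  "direct_sum_rep A V = \<lparr>
     rep_space = (\<Pi>\<^sub>E i\<in>A. rep_space (V i)),
     rep_add = (\<lambda>u v. \<lambda>i\<in>A. rep_add (V i) (u i) (v i)),
     rep_zero = (\<lambda>i\<in>A. rep_zero (V i)),
     rep_scale = (\<lambda>a v. \<lambda>i\<in>A. rep_scale (V i) a (v i)),
     rep_act = (\<lambda>\<sigma> v. \<lambda>i\<in>A. rep_act (V i) \<sigma> (v i)),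
     rep_component = (\<lambda>e. \<Pi>\<^sub>E i\<in>A. rep_component (V i) e) \<rparr>"

subsection \<open>Graded characters\<close>

definition lincomb :: "('n, 'k, 'v) graded_rep \<Rightarrow> 'k list \<Rightarrow> 'v list \<Rightarrow> 'v" where
  "lincomb V as vs = foldr (rep_add V) (map2 (rep_scale V) as vs) (rep_zero V)"

definition is_basis :: "('n, 'k, 'v) graded_rep \<Rightarrow> 'v set \<Rightarrow> 'v list \<Rightarrow> bool" where
  "is_basis V U bs \<longleftrightarrow> set bs \<subseteq> U
     \<and> (\<forall>v\<in>U. \<exists>!as. length as = length bs \<and> lincomb V as bs = v)"

definition coords :: "('n, 'k, 'v) graded_rep \<Rightarrow> 'v list \<Rightarrow> 'v \<Rightarrow> 'k list" where
  "coords V bs v = (THE as. length as = length bs \<and> lincomb V as bs = v)"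

text \<open>
  Trace of a linear endomorphism \<open>T\<close> of a finite-dimensional subspace \<open>U\<close>: the sum of the diagonal
  entries of its matrix in some basis (the value does not depend on the basis).
\<close>

definition trace_on :: "('n, 'k::field, 'v) graded_rep \<Rightarrow> 'v set \<Rightarrow> ('v \<Rightarrow> 'v) \<Rightarrow> 'k" where
  "trace_on V U T = (let bs = (SOME bs. is_basis V U bs)
     in \<Sum>i<length bs. coords V bs (T (bs ! i)) ! i)"

definition character :: "('n, 'k::field, 'v) graded_rep \<Rightarrow> nat \<Rightarrow> ('n, 'k) class_fun" where
  "character V e = Class_fun (\<lambda>\<sigma>. trace_on V (rep_component V e) (rep_act V \<sigma>))"

definition graded_character :: "('n, 'k::field, 'v) graded_rep \<Rightarrow> ('n, 'k) class_fun fps" where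
  "graded_character V = Abs_fps (character V)"

end

theory Submission
  imports Defs
begin

text \<open>
  Multiplication by an element \<open>f\<close> of degree \<open>D\<close> that is a nonzerodivisor on \<open>R / J\<close>, and on which
  the group acts through a linear character \<open>\<chi>\<close>, gives an equivariant exact sequence
  \<open>0 \<rightarrow> (R / J) (- D) \<otimes> \<chi> \<rightarrow> R / J \<rightarrow> R / (J + (f)) \<rightarrow> 0\<close>, so it multiplies the graded character by
  \<open>1 - \<chi> t\<^sup>D\<close>.  The formula therefore follows once \<open>I\<close> is generated by a regular sequence
  \<open>f\<^sub>0, \<dots>, f\<^sub>m\<close> of homogeneous elements with \<open>f\<^sub>0\<close> alternating of degree \<open>d\<close> and \<open>f\<^sub>i\<close> invariant of
  degree \<open>c i\<close>.

  Such elements are obtained by lifting a basis of \<open>I / \<mm> I\<close> adapted to the given decomposition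
  and averaging over the group (\<open>semi_invariant_minimal_generators\<close>); they generate \<open>I\<close> by
  Nakayama's lemma.  The substance is that they form a regular sequence, knowing only that some
  sequence \<open>g\<close>, possibly inhomogeneous, generates \<open>I\<close> and is regular.  The link between the two is
  the vanishing of the first Koszul homology, i.e. the property that all syzygies are combinations
  of the trivial ones.  It holds for \<open>g\<close>; it passes from \<open>g\<close> to \<open>f\<close> modulo \<open>\<mm>\<close> times the
  syzygies of \<open>f\<close> (\<open>syzygy_change_of_generators\<close>), hence entirely, by Nakayama's lemma for the
  graded module of syzygies (\<open>minimal_generators_koszul_acyclic\<close>).  For homogeneous elements of
  positive degree it is inherited by every prefix (\<open>koszul_acyclic_prefix\<close>), and it then says that
  each \<open>f\<^sub>i\<close> is a nonzerodivisor modulo its predecessors.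

  For the character computation, traces on quotients are expressed through families of
  representatives in \<open>R\<close>: \<open>rel_trace_additive\<close> is additivity in short exact sequences,
  \<open>rel_trace_transfer\<close> invariance under twisted isomorphisms, and \<open>poly_projection.trace_on_proj\<close>
  identifies these relative traces with the traces in the definition of the graded character.
\<close>

section \<open>Ideals and syzygies\<close>

abbreviation ring_ideal :: "'a::comm_ring_1 set \<Rightarrow> bool" where
  "ring_ideal \<equiv> module.subspace (*)"

lemma module_self: "module ((*) :: 'a::comm_ring_1 \<Rightarrow> 'a \<Rightarrow> 'a)"
  by unfold_locales (simp_all add: algebra_simps)

lemmas ring_ideal_zero = module.subspace_0[OF module_self]
  and ring_ideal_add = module.subspace_add[OF module_self]
  and ring_ideal_mult = module.subspace_scale[OF module_self]
  and ring_ideal_neg = module.subspace_neg[OF module_self]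
  and ring_ideal_sum = module.subspace_sum[OF module_self]

lemma ring_ideal_ideal_gen: "ring_ideal (ideal_gen S)"
  unfolding ideal_gen_def by (rule module.subspace_span[OF module_self])

lemma ideal_gen_base: "x \<in> S \<Longrightarrow> x \<in> ideal_gen S"
  unfolding ideal_gen_def by (rule module.span_base[OF module_self])

lemma ideal_gen_subset: "S \<subseteq> J \<Longrightarrow> ring_ideal J \<Longrightarrow> ideal_gen S \<subseteq> J"
  unfolding ideal_gen_def by (rule module.span_minimal[OF module_self])

lemma ideal_gen_image_lessThan:
  fixes f :: "nat \<Rightarrow> 'a::comm_ring_1"
  shows "ideal_gen (f ` {..<n}) = {\<Sum>i<n. a i * f i | a. True}" (is "_ = ?J")
proof
  have "ring_ideal ?J"
  proof (subst module.subspace_def[OF module_self], safe)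
    show "\<exists>a. 0 = (\<Sum>i<n. a i * f i) \<and> True"
      by (rule exI[of _ "\<lambda>_. 0"]) simp
  next
    fix a b show "\<exists>c. (\<Sum>i<n. a i * f i) + (\<Sum>i<n. b i * f i) = (\<Sum>i<n. c i * f i) \<and> True"
      by (rule exI[of _ "\<lambda>i. a i + b i"]) (simp add: sum.distrib algebra_simps)
  next
    fix r a show "\<exists>c. r * (\<Sum>i<n. a i * f i) = (\<Sum>i<n. c i * f i) \<and> True"
      by (rule exI[of _ "\<lambda>i. r * a i"]) (simp add: sum_distrib_left algebra_simps)
  qed
  moreover have "f ` {..<n} \<subseteq> ?J"
  proof safe
    fix i assume i: "i < n"
    have "(\<Sum>l<n. (if l = i then 1 else 0) * f l) = (\<Sum>l<n. if l = i then f l else 0)"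
      by (rule sum.cong) auto
    also have "\<dots> = f i" using i by (simp add: sum.delta)
    finally show "\<exists>a. f i = (\<Sum>l<n. a l * f l) \<and> True"
      by (intro exI[of _ "\<lambda>l. if l = i then 1 else 0"]) simp
  qed
  ultimately show "ideal_gen (f ` {..<n}) \<subseteq> ?J" by (intro ideal_gen_subset)
next
  show "?J \<subseteq> ideal_gen (f ` {..<n})"
    using ring_ideal_ideal_gen[of "f ` {..<n}"] ideal_gen_base[of _ "f ` {..<n}"]
    by (auto intro!: ring_ideal_sum ring_ideal_mult)
qed

lemma mem_ideal_gen_image_lessThan:
  fixes f :: "nat \<Rightarrow> 'a::comm_ring_1"
  shows "x \<in> ideal_gen (f ` {..<n}) \<longleftrightarrow> (\<exists>a. x = (\<Sum>i<n. a i * f i))"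
  unfolding ideal_gen_image_lessThan by auto

definition syzygy :: "nat \<Rightarrow> (nat \<Rightarrow> 'a::comm_ring_1) \<Rightarrow> (nat \<Rightarrow> 'a) \<Rightarrow> bool" where
  "syzygy n f a \<longleftrightarrow> (\<Sum>i<n. a i * f i) = 0"

text \<open>
  These are the combinations of the trivial relations \<open>f\<^sub>j e\<^sub>i - f\<^sub>i e\<^sub>j\<close>, i.e. the boundaries in
  degree 1 of the Koszul complex.  Writing the alternating coefficient matrix as \<open>T - T\<^sup>t\<close> keeps
  the diagonal zero and is compatible with the base changes \<open>T \<mapsto> B\<^sup>t T B\<close> over every ring.
\<close>

definition koszul_syzygy :: "nat \<Rightarrow> (nat \<Rightarrow> 'a::comm_ring_1) \<Rightarrow> (nat \<Rightarrow> 'a) \<Rightarrow> bool" where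
  "koszul_syzygy n f a \<longleftrightarrow> (\<exists>T. \<forall>i<n. a i = (\<Sum>j<n. (T i j - T j i) * f j))"

definition nonzerodivisor_chain :: "nat \<Rightarrow> (nat \<Rightarrow> 'a::comm_ring_1) \<Rightarrow> bool" where
  "nonzerodivisor_chain n f \<longleftrightarrow>
     (\<forall>i<n. \<forall>x. x * f i \<in> ideal_gen (f ` {..<i}) \<longrightarrow> x \<in> ideal_gen (f ` {..<i}))"

text \<open>
  The coefficient of the last element lies in the ideal of the preceding ones, so a trivial
  relation cancels it, and what remains is a syzygy of the shorter sequence.
\<close>

lemma syzygy_imp_koszul_syzygy:
  assumes "nonzerodivisor_chain n g" "syzygy n g a"
  shows "koszul_syzygy n g a"
  using assms
proof (induction n arbitrary: a)
  case 0
  then show ?case by (simp add: koszul_syzygy_def)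
next
  case (Suc n)
  have reg: "nonzerodivisor_chain n g"
    using Suc.prems(1) by (auto simp: nonzerodivisor_chain_def)
  have rel: "(\<Sum>i<n. a i * g i) + a n * g n = 0"
    using Suc.prems(2) by (simp add: syzygy_def)
  then have "a n * g n = (\<Sum>i<n. (- a i) * g i)"
    by (simp add: sum_negf eq_neg_iff_add_eq_0 add.commute)
  then have "a n * g n \<in> ideal_gen (g ` {..<n})"
    unfolding mem_ideal_gen_image_lessThan by (rule exI[of _ "\<lambda>i. - a i"])
  then have "a n \<in> ideal_gen (g ` {..<n})"
    using Suc.prems(1) by (auto simp: nonzerodivisor_chain_def)
  then obtain b where b: "a n = (\<Sum>i<n. b i * g i)"
    unfolding mem_ideal_gen_image_lessThan by blast
  have "syzygy n g (\<lambda>i. a i + b i * g n)"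
    using rel unfolding syzygy_def b
    by (simp add: sum.distrib algebra_simps sum_distrib_left)
  then obtain T where T: "\<And>i. i < n \<Longrightarrow> a i + b i * g n = (\<Sum>j<n. (T i j - T j i) * g j)"
    using Suc.IH[OF reg] unfolding koszul_syzygy_def by blast
  define T' where "T' i j = (if i < n \<and> j < n then T i j else if i < n then - b i else 0)" for i j
  have "a i = (\<Sum>j<Suc n. (T' i j - T' j i) * g j)" if "i < Suc n" for i
  proof (cases "i < n")
    case True
    then have "(\<Sum>j<n. (T' i j - T' j i) * g j) = a i + b i * g n"
      by (auto simp: T T'_def intro!: sum.cong)
    then show ?thesis using True by (simp add: T'_def)
  next
    case False
    then have "i = n" using that by simp
    then show ?thesis by (simp add: T'_def b)
  qed
  then show ?case unfolding koszul_syzygy_def by blast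
qed

text \<open>
  Writing \<open>f = A g\<close> and \<open>g = B f\<close>, a syzygy \<open>a\<close> of \<open>f\<close> gives the syzygy \<open>A\<^sup>t a\<close> of \<open>g\<close>, and \<open>B\<^sup>t\<close>
  carries Koszul syzygies of \<open>g\<close> to those of \<open>f\<close>.  What is left is \<open>(1 - A B)\<^sup>t a\<close>, a combination of
  the rows of \<open>1 - A B\<close>; these are themselves syzygies because \<open>f = A B f\<close>.
\<close>

lemma syzygy_change_of_generators:
  fixes f g :: "nat \<Rightarrow> 'a::comm_ring_1"
  assumes f: "\<And>i. i < s \<Longrightarrow> f i \<in> ideal_gen (g ` {..<r})"
    and g: "\<And>l. l < r \<Longrightarrow> g l \<in> ideal_gen (f ` {..<s})"
    and koszul: "\<And>c. syzygy r g c \<Longrightarrow> koszul_syzygy r g c"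
    and a: "syzygy s f a"
  obtains k row where "koszul_syzygy s f k" "\<And>i. i < s \<Longrightarrow> syzygy s f (row i)"
    "\<And>j. j < s \<Longrightarrow> a j = k j + (\<Sum>i<s. a i * row i j)"
proof -
  have "\<forall>i. \<exists>A. i < s \<longrightarrow> f i = (\<Sum>l<r. A l * g l)"
    using f unfolding mem_ideal_gen_image_lessThan by blast
  then obtain A where A: "\<And>i. i < s \<Longrightarrow> f i = (\<Sum>l<r. A i l * g l)" by metis
  have "\<forall>l. \<exists>B. l < r \<longrightarrow> g l = (\<Sum>i<s. B i * f i)"
    using g unfolding mem_ideal_gen_image_lessThan by blast
  then obtain B where B: "\<And>l. l < r \<Longrightarrow> g l = (\<Sum>i<s. B l i * f i)" by metis
  define AB where "AB i j = (\<Sum>l<r. A i l * B l j)" for i j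
  define row where "row i j = (if i = j then 1 else 0) - AB i j" for i j
  define c where "c l = (\<Sum>i<s. a i * A i l)" for l
  define k where "k j = (\<Sum>i<s. a i * AB i j)" for j
  have k_alt: "k j = (\<Sum>l<r. c l * B l j)" for j
    unfolding k_def c_def AB_def sum_distrib_left sum_distrib_right
    by (subst sum.swap) (simp add: mult.assoc)
  have "(\<Sum>l<r. c l * g l) = (\<Sum>i<s. a i * (\<Sum>l<r. A i l * g l))"
    unfolding c_def sum_distrib_left sum_distrib_right
    by (subst sum.swap) (simp add: mult.assoc)
  also have "\<dots> = (\<Sum>i<s. a i * f i)" using A by simp
  finally have "syzygy r g c" using a by (simp add: syzygy_def)
  from koszul[OF this] obtain T where T: "\<And>l. l < r \<Longrightarrow> c l = (\<Sum>p<r. (T l p - T p l) * g p)"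
    unfolding koszul_syzygy_def by blast
  define U where "U j i = (\<Sum>l<r. \<Sum>p<r. B l j * T l p * B p i)" for j i
  have U_swap: "U i j = (\<Sum>l<r. \<Sum>p<r. B l j * T p l * B p i)" for j i
    unfolding U_def by (subst sum.swap) (simp add: mult_ac)
  have U_diff: "U j i - U i j = (\<Sum>l<r. \<Sum>p<r. B l j * (T l p - T p l) * B p i)" for j i
    unfolding U_swap[of i j] unfolding U_def
    by (simp add: sum_subtractf[symmetric] algebra_simps)
  have "k j = (\<Sum>i<s. (U j i - U i j) * f i)" for j
  proof -
    have "k j = (\<Sum>l<r. (\<Sum>p<r. (T l p - T p l) * (\<Sum>i<s. B p i * f i)) * B l j)"
      using T B by (simp add: k_alt)
    also have "\<dots> = (\<Sum>l<r. \<Sum>p<r. \<Sum>i<s. B l j * (T l p - T p l) * B p i * f i)"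
      by (simp add: sum_distrib_left sum_distrib_right mult_ac)
    also have "\<dots> = (\<Sum>l<r. \<Sum>i<s. \<Sum>p<r. B l j * (T l p - T p l) * B p i * f i)"
      by (rule sum.cong[OF refl sum.swap])
    also have "\<dots> = (\<Sum>i<s. \<Sum>l<r. \<Sum>p<r. B l j * (T l p - T p l) * B p i * f i)"
      by (rule sum.swap)
    also have "\<dots> = (\<Sum>i<s. (U j i - U i j) * f i)"
      by (simp add: U_diff sum_distrib_right)
    finally show ?thesis .
  qed
  then have "koszul_syzygy s f k" unfolding koszul_syzygy_def by blast
  moreover have "syzygy s f (row i)" if i: "i < s" for i
  proof -
    have "(\<Sum>j<s. AB i j * f j) = (\<Sum>l<r. A i l * (\<Sum>j<s. B l j * f j))"
      unfolding AB_def sum_distrib_left sum_distrib_right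
      by (subst sum.swap) (simp add: mult.assoc)
    also have "\<dots> = f i" using A[OF i] B by simp
    finally have "(\<Sum>j<s. AB i j * f j) = f i" .
    moreover have "(\<Sum>j<s. (if i = j then 1 else 0) * f j) = (\<Sum>j<s. if j = i then f j else 0)"
      by (rule sum.cong) auto
    ultimately show ?thesis
      using i unfolding syzygy_def row_def by (simp add: left_diff_distrib sum_subtractf)
  qed
  moreover have "a j = k j + (\<Sum>i<s. a i * row i j)" if j: "j < s" for j
  proof -
    have "(\<Sum>i<s. a i * (if i = j then 1 else 0)) = (\<Sum>i<s. if i = j then a i else 0)"
      by (rule sum.cong) auto
    then show ?thesis
      using j unfolding row_def k_def by (simp add: right_diff_distrib sum_subtractf)
  qed
  ultimately show ?thesis by (rule that)
qed

section \<open>Homogeneous components\<close>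

lemma lookup_Const_mult: "Poly_Mapping.lookup (Const a * f) b = a * Poly_Mapping.lookup f b"
  by (simp add: Const_def mult_map_scale_conv_mult[symmetric] Poly_Mapping.map.rep_eq when_def)

lemma Const_add: "Const (a + b) = Const a + Const b"
  and Const_mult: "Const (a * b) = Const a * Const b"
  and Const_zero: "Const 0 = 0"
  and Const_one: "Const 1 = 1"
  by (simp_all add: Const_def single_add mult_single)

lemma Const_sum: "Const (sum g A) = (\<Sum>x\<in>A. Const (g x))"
  by (induction A rule: infinite_finite_induct) (simp_all add: Const_zero Const_add)

lemma monom_degree_add: "monom_degree (a + b) = monom_degree a + monom_degree b"
  by (simp add: monom_degree_def lookup_add sum.distrib)

lemma monom_degree_single: "monom_degree (Poly_Mapping.single i k) = k"
  by (simp add: monom_degree_def lookup_single when_def)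

lemma mem_homogeneous_part_iff:
  "f \<in> homogeneous_part e \<longleftrightarrow> (\<forall>a. monom_degree a \<noteq> e \<longrightarrow> Poly_Mapping.lookup f a = 0)"
  unfolding homogeneous_part_def by (auto simp: in_keys_iff)

text \<open>
  Degrees are integers so that shifting by the degree of a factor needs no case distinction:
  components of negative degree vanish.
\<close>

lift_definition hom_part :: "int \<Rightarrow> ('n::finite, 'k::zero) mpoly \<Rightarrow> ('n, 'k) mpoly"
  is "\<lambda>k f a. if int (monom_degree a) = k then f a else 0"
  by (rule finite_subset) auto

lemma lookup_hom_part:
  "Poly_Mapping.lookup (hom_part k f) a = (if int (monom_degree a) = k then Poly_Mapping.lookup f a else 0)"
  by (simp add: hom_part.rep_eq)

lemma hom_part_zero [simp]: "hom_part k 0 = 0"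
  and hom_part_add: "hom_part k (f + g) = hom_part k f + hom_part k g"
  for f g :: "('n::finite, 'k::comm_ring_1) mpoly"
  by (rule poly_mapping_eqI; simp add: lookup_hom_part lookup_add)+

lemma hom_part_diff: "hom_part k (f - g) = hom_part k f - hom_part k g"
  for f g :: "('n::finite, 'k::comm_ring_1) mpoly"
  by (rule poly_mapping_eqI) (simp add: lookup_hom_part lookup_minus)

lemma hom_part_sum: "hom_part k (sum f A) = (\<Sum>x\<in>A. hom_part k (f x))"
  for f :: "'a \<Rightarrow> ('n::finite, 'k::comm_ring_1) mpoly"
  by (induction A rule: infinite_finite_induct) (simp_all add: hom_part_add)

lemma hom_part_negative: "k < 0 \<Longrightarrow> hom_part k f = 0"
  by (rule poly_mapping_eqI) (simp add: lookup_hom_part)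

lemma hom_part_mem: "hom_part (int e) f \<in> homogeneous_part e"
  by (simp add: mem_homogeneous_part_iff lookup_hom_part)

lemma hom_part_homogeneous:
  "f \<in> homogeneous_part e \<Longrightarrow> hom_part k f = (if k = int e then f else 0)"
  by (rule poly_mapping_eqI) (auto simp: lookup_hom_part mem_homogeneous_part_iff)

lemma homogeneous_part_zero: "0 \<in> homogeneous_part e"
  and homogeneous_part_add:
    "f \<in> homogeneous_part e \<Longrightarrow> g \<in> homogeneous_part e \<Longrightarrow> f + g \<in> homogeneous_part e"
  and homogeneous_part_scale:
    "f \<in> homogeneous_part e \<Longrightarrow> Const a * f \<in> homogeneous_part e"
  by (simp_all add: mem_homogeneous_part_iff lookup_add lookup_Const_mult)

lemma homogeneous_part_sum:
  "(\<And>x. x \<in> A \<Longrightarrow> f x \<in> homogeneous_part e) \<Longrightarrow> sum f A \<in> homogeneous_part e"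
  by (induction A rule: infinite_finite_induct)
    (simp_all add: homogeneous_part_zero homogeneous_part_add)

lemma homogeneous_part_mult:
  assumes "f \<in> homogeneous_part i" "g \<in> homogeneous_part j"
  shows "f * g \<in> homogeneous_part (i + j)"
  using assms keys_mult[of f g] unfolding homogeneous_part_def by (force simp: monom_degree_add)

lemma Var_homogeneous: "Var v \<in> homogeneous_part 1"
  by (auto simp: homogeneous_part_def Var_def monom_degree_single split: if_splits)

text \<open>
  The shift by \<open>d\<close> only adds vanishing components; with it, entries of a tuple whose degrees are
  shifted differently can be decomposed by one common range of summation.
\<close>

lemma sum_hom_part:
  fixes f :: "('n::finite, 'k::comm_ring_1) mpoly"
  obtains E where "\<And>E'. E \<le> E' \<Longrightarrow> f = (\<Sum>e<E'. hom_part (int e - int d) f)"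
proof
  define E where "E = Suc (Max (insert 0 (monom_degree ` Poly_Mapping.keys f)) + d)"
  fix E' assume E': "E \<le> E'"
  show "f = (\<Sum>e<E'. hom_part (int e - int d) f)"
  proof (rule poly_mapping_eqI)
    fix a
    have "Poly_Mapping.lookup (\<Sum>e<E'. hom_part (int e - int d) f) a =
        (\<Sum>e<E'. if e = monom_degree a + d then Poly_Mapping.lookup f a else 0)"
      unfolding lookup_sum lookup_hom_part by (rule sum.cong) auto
    also have "\<dots> = Poly_Mapping.lookup f a"
    proof (cases "a \<in> Poly_Mapping.keys f")
      case True
      then have "monom_degree a \<le> Max (insert 0 (monom_degree ` Poly_Mapping.keys f))" by simp
      then show ?thesis using E' by (simp add: E_def)
    qed (simp add: in_keys_iff)
    finally show "Poly_Mapping.lookup f a = Poly_Mapping.lookup (\<Sum>e<E'. hom_part (int e - int d) f) a" by simp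
  qed
qed

lemma hom_part_mult:
  fixes f g :: "('n::finite, 'k::comm_ring_1) mpoly"
  assumes g: "g \<in> homogeneous_part D"
  shows "hom_part k (f * g) = hom_part (k - int D) f * g"
proof -
  obtain E where E: "\<And>E'. E \<le> E' \<Longrightarrow> f = (\<Sum>e<E'. hom_part (int e - int 0) f)"
    using sum_hom_part by blast
  define E' where "E' = Suc (max E (nat (k - int D)))"
  have "hom_part k (f * g) = hom_part k ((\<Sum>e<E'. hom_part (int e) f) * g)"
    using E[of E'] by (simp add: E'_def)
  also have "\<dots> = (\<Sum>e<E'. hom_part k (hom_part (int e) f * g))"
    by (simp add: sum_distrib_right hom_part_sum)
  also have "\<dots> = (\<Sum>e<E'. if k - int D = int e then hom_part (k - int D) f * g else 0)"
    by (intro sum.cong refl)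
      (auto simp: hom_part_homogeneous[OF homogeneous_part_mult[OF hom_part_mem g]])
  also have "\<dots> = hom_part (k - int D) f * g"
  proof (cases "0 \<le> k - int D")
    case True
    then have "(k - int D = int e) = (e = nat (k - int D))" for e by auto
    then show ?thesis by (simp add: E'_def)
  qed (auto simp: hom_part_negative)
  finally show ?thesis .
qed

definition graded_ideal :: "('n::finite, 'k::comm_ring_1) mpoly set \<Rightarrow> bool" where
  "graded_ideal J \<longleftrightarrow> ring_ideal J \<and> (\<forall>f\<in>J. \<forall>k. hom_part k f \<in> J)"

lemma graded_ideal_ideal_gen:
  assumes H: "H \<subseteq> (\<Union>e. homogeneous_part e)"
  shows "graded_ideal (ideal_gen H)"
proof -
  have "hom_part k f \<in> ideal_gen H" if "f \<in> ideal_gen H" for f k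
    using that unfolding ideal_gen_def
  proof (induction rule: module.span_induct_alt[OF module_self, consumes 1, case_names base step])
    case base
    show ?case by (simp add: module.span_zero[OF module_self])
  next
    case (step c x y)
    then obtain D where "x \<in> homogeneous_part D" using H by blast
    then show ?case
      using step by (simp add: hom_part_add hom_part_mult module.span_add[OF module_self]
          module.span_scale[OF module_self] module.span_base[OF module_self])
  qed
  then show ?thesis by (simp add: graded_ideal_def ring_ideal_ideal_gen)
qed

section \<open>Nakayama's lemma for graded modules\<close>

text \<open>
  Tuples are graded by giving the \<open>i\<close>-th basis vector the degree \<open>D i\<close>.  If \<open>M \<subseteq> K + \<Sum> h\<^sub>l M\<close> with
  all \<open>h\<^sub>l\<close> of positive degree, then the degree \<open>e\<close> component of an element of \<open>M\<close> lies in \<open>K\<close>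
  once this is known in lower degrees; as degrees are bounded below, this is an induction.
\<close>

lemma graded_nakayama:
  fixes M K :: "(nat \<Rightarrow> ('n::finite, 'k::comm_ring_1) mpoly) set" and D :: "nat \<Rightarrow> nat"
  assumes zero: "(\<lambda>_. 0) \<in> K"
    and add: "\<And>a b. a \<in> K \<Longrightarrow> b \<in> K \<Longrightarrow> (\<lambda>i. a i + b i) \<in> K"
    and mult: "\<And>r a. a \<in> K \<Longrightarrow> (\<lambda>i. r * a i) \<in> K"
    and component: "\<And>e a. a \<in> K \<Longrightarrow> (\<lambda>i. hom_part (int e - int (D i)) (a i)) \<in> K"
    and ext: "\<And>a b. a \<in> K \<Longrightarrow> (\<And>i. i < s \<Longrightarrow> a i = b i) \<Longrightarrow> b \<in> K"
    and L: "finite L" "\<And>l. l \<in> L \<Longrightarrow> h l \<in> homogeneous_part (\<delta> l)" "\<And>l. l \<in> L \<Longrightarrow> 0 < \<delta> l"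
    and decomp: "\<And>a. a \<in> M \<Longrightarrow>
      \<exists>k\<in>K. \<exists>n. (\<forall>l\<in>L. n l \<in> M) \<and> (\<forall>i<s. a i = k i + (\<Sum>l\<in>L. h l * n l i))"
    and a: "a \<in> M"
  shows "a \<in> K"
proof -
  have sum: "(\<lambda>i. \<Sum>l\<in>A. b l i) \<in> K" if "\<And>l. l \<in> A \<Longrightarrow> b l \<in> K"
    for A :: "'x set" and b :: "'x \<Rightarrow> nat \<Rightarrow> ('n, 'k) mpoly"
    using that by (induction A rule: infinite_finite_induct) (simp_all add: zero add)
  let ?c = "\<lambda>e a i. hom_part (int e - int (D i)) (a i)"
  have components: "?c e a \<in> K" if "a \<in> M" for e a
    using that
  proof (induction e arbitrary: a rule: less_induct)
    case (less e)
    obtain k n where k: "k \<in> K" and n: "\<And>l. l \<in> L \<Longrightarrow> n l \<in> M"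
      and a: "\<And>i. i < s \<Longrightarrow> a i = k i + (\<Sum>l\<in>L. h l * n l i)"
      using decomp[OF less.prems] by blast
    \<comment> \<open>the \<open>l\<close>-th term contributes the component of \<open>n l\<close> in the lower degree \<open>e - \<delta> l\<close>\<close>
    define b where "b l = (if \<delta> l \<le> e then (\<lambda>i. h l * ?c (e - \<delta> l) (n l) i) else (\<lambda>_. 0))" for l
    have "b l \<in> K" if l: "l \<in> L" for l
    proof (cases "\<delta> l \<le> e")
      case True
      then have "e - \<delta> l < e" using L(3)[OF l] by simp
      then have "?c (e - \<delta> l) (n l) \<in> K" using n[OF l] by (rule less.IH)
      then show ?thesis using True mult unfolding b_def by simp
    qed (simp add: b_def zero)
    then have "(\<lambda>i. ?c e k i + (\<Sum>l\<in>L. b l i)) \<in> K"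
      using k by (intro add component sum)
    moreover have "?c e k i + (\<Sum>l\<in>L. b l i) = ?c e a i" if i: "i < s" for i
    proof -
      have "b l i = hom_part (int e - int (D i)) (h l * n l i)" if l: "l \<in> L" for l
      proof -
        have "hom_part (int e - int (D i)) (n l i * h l) =
            hom_part (int e - int (D i) - int (\<delta> l)) (n l i) * h l"
          using L(2)[OF l] by (rule hom_part_mult)
        moreover have "int e - int (D i) - int (\<delta> l) = int (e - \<delta> l) - int (D i)"
          if "\<delta> l \<le> e" using that by simp
        ultimately have "hom_part (int e - int (D i)) (h l * n l i) =
            (if \<delta> l \<le> e then h l * ?c (e - \<delta> l) (n l) i else 0)"
          by (auto simp: mult.commute[of "h l"] hom_part_negative
              cancel_ab_semigroup_add_class.diff_right_commute)
        then show ?thesis by (simp add: b_def)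
      qed
      then show ?thesis using a[OF i] by (simp add: hom_part_add hom_part_sum)
    qed
    ultimately show ?case by (rule ext)
  qed
  have "\<forall>i. \<exists>E. \<forall>E'\<ge>E. a i = (\<Sum>e<E'. ?c e a i)"
    using sum_hom_part by metis
  then obtain E where E: "\<And>i E'. E i \<le> E' \<Longrightarrow> a i = (\<Sum>e<E'. ?c e a i)" by metis
  have "(\<lambda>i. \<Sum>e<(\<Sum>l<s. E l). ?c e a i) \<in> K"
    using components[OF a] by (rule sum)
  moreover have "(\<Sum>e<(\<Sum>l<s. E l). ?c e a i) = a i" if "i < s" for i
    using that by (intro E[symmetric] member_le_sum) auto
  ultimately show ?thesis by (rule ext)
qed

section \<open>Minimal generators of a homogeneous complete intersection\<close>

text \<open>Vanishing of the first Koszul homology.\<close>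

definition koszul_acyclic :: "nat \<Rightarrow> (nat \<Rightarrow> 'a::comm_ring_1) \<Rightarrow> bool" where
  "koszul_acyclic n f \<longleftrightarrow> (\<forall>a. syzygy n f a \<longrightarrow> koszul_syzygy n f a)"

lemma koszul_syzygy_zero: "koszul_syzygy n f (\<lambda>_. 0)"
  unfolding koszul_syzygy_def by (rule exI[of _ "\<lambda>_ _. 0"]) simp

lemma koszul_syzygy_add:
  assumes "koszul_syzygy n f a" "koszul_syzygy n f b"
  shows "koszul_syzygy n f (\<lambda>i. a i + b i)"
proof -
  obtain T U where "\<forall>i<n. a i = (\<Sum>j<n. (T i j - T j i) * f j)"
    "\<forall>i<n. b i = (\<Sum>j<n. (U i j - U j i) * f j)"
    using assms unfolding koszul_syzygy_def by blast
  then show ?thesis unfolding koszul_syzygy_def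
    by (intro exI[of _ "\<lambda>i j. T i j + U i j"]) (simp add: sum.distrib[symmetric] algebra_simps)
qed

lemma koszul_syzygy_mult:
  assumes "koszul_syzygy n f a"
  shows "koszul_syzygy n f (\<lambda>i. r * a i)"
proof -
  obtain T where "\<forall>i<n. a i = (\<Sum>j<n. (T i j - T j i) * f j)"
    using assms unfolding koszul_syzygy_def by blast
  then show ?thesis unfolding koszul_syzygy_def
    by (intro exI[of _ "\<lambda>i j. r * T i j"]) (simp add: sum_distrib_left algebra_simps)
qed

lemma koszul_syzygy_cong:
  "koszul_syzygy n f a \<Longrightarrow> (\<And>i. i < n \<Longrightarrow> a i = b i) \<Longrightarrow> koszul_syzygy n f b"
  unfolding koszul_syzygy_def by auto

lemma koszul_syzygy_hom_part:
  assumes f: "\<And>i. i < n \<Longrightarrow> f i \<in> homogeneous_part (D i)"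
    and "koszul_syzygy n f a"
  shows "koszul_syzygy n f (\<lambda>i. hom_part (e - int (D i)) (a i))"
proof -
  obtain T where T: "\<And>i. i < n \<Longrightarrow> a i = (\<Sum>j<n. (T i j - T j i) * f j)"
    using assms unfolding koszul_syzygy_def by blast
  let ?U = "\<lambda>i j. hom_part (e - int (D i) - int (D j)) (T i j)"
  have "hom_part (e - int (D i)) (a i) = (\<Sum>j<n. (?U i j - ?U j i) * f j)" if "i < n" for i
    unfolding T[OF that] hom_part_sum
    by (intro sum.cong refl) (simp add: hom_part_mult[OF f] hom_part_diff
        cancel_ab_semigroup_add_class.diff_right_commute)
  then show ?thesis unfolding koszul_syzygy_def by (intro exI[of _ ?U]) blast
qed

text \<open>
  A relation \<open>x f\<^sub>n = \<Sum> b\<^sub>i f\<^sub>i\<close> is a syzygy, and the \<open>n\<close>-th coefficient of a Koszul syzygy does not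
  involve \<open>f\<^sub>n\<close>.
\<close>

lemma koszul_acyclic_Suc_nonzerodivisor:
  assumes acyclic: "koszul_acyclic (Suc n) f" and x: "x * f n \<in> ideal_gen (f ` {..<n})"
  shows "x \<in> ideal_gen (f ` {..<n})"
proof -
  obtain b where b: "x * f n = (\<Sum>i<n. b i * f i)"
    using x unfolding mem_ideal_gen_image_lessThan by blast
  define a where "a = (\<lambda>i. - b i)(n := x)"
  have "(\<Sum>i<n. a i * f i) = (\<Sum>i<n. (- b i) * f i)" by (rule sum.cong) (auto simp: a_def)
  then have "syzygy (Suc n) f a" by (simp add: syzygy_def a_def b sum_negf)
  then obtain T where "\<forall>i<Suc n. a i = (\<Sum>j<Suc n. (T i j - T j i) * f j)"
    using acyclic unfolding koszul_acyclic_def koszul_syzygy_def by blast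
  then have "a n = (\<Sum>j<Suc n. (T n j - T j n) * f j)" by blast
  then have "x = (\<Sum>j<n. (T n j - T j n) * f j)" by (simp add: a_def)
  then show ?thesis
    unfolding mem_ideal_gen_image_lessThan by (rule exI[of _ "\<lambda>j. T n j - T j n"])
qed

text \<open>
  Extending a syzygy of the prefix by a zero coefficient gives a Koszul syzygy, and because of the
  zero the last row of its alternating matrix is a further syzygy of the prefix.  So every syzygy of the prefix is Koszul modulo
  \<open>f\<^sub>n\<close> times the syzygies, and Nakayama's lemma applies as \<open>f\<^sub>n\<close> has positive degree.
\<close>

lemma koszul_acyclic_prefix:
  assumes f: "\<And>i. i < Suc n \<Longrightarrow> f i \<in> homogeneous_part (D i)" and pos: "0 < D n"
    and acyclic: "koszul_acyclic (Suc n) f"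
  shows "koszul_acyclic n f"
proof -
  have "a \<in> Collect (koszul_syzygy n f)" if "a \<in> Collect (syzygy n f)" for a
  proof (rule graded_nakayama[where M = "Collect (syzygy n f)" and L = "{n}" and h = f
        and \<delta> = D and D = D and s = n])
    fix a assume "a \<in> Collect (syzygy n f)"
    then have "syzygy (Suc n) f (a(n := 0))"
      by (simp add: syzygy_def)
    then obtain T where T: "\<forall>i<Suc n. (a(n := 0)) i = (\<Sum>j<Suc n. (T i j - T j i) * f j)"
      using acyclic unfolding koszul_acyclic_def koszul_syzygy_def by blast
    let ?k = "\<lambda>i. \<Sum>j<n. (T i j - T j i) * f j"
    let ?row = "\<lambda>i. T i n - T n i"
    have "(a(n := 0)) n = (\<Sum>j<Suc n. (T n j - T j n) * f j)" using T by blast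
    then have "(\<Sum>j<n. (T n j - T j n) * f j) = 0" by simp
    moreover have "(\<Sum>i<n. ?row i * f i) = - (\<Sum>j<n. (T n j - T j n) * f j)"
      unfolding sum_negf[symmetric] by (intro sum.cong refl) (simp add: algebra_simps)
    ultimately have "syzygy n f ?row" by (simp add: syzygy_def)
    moreover have "a i = ?k i + f n * ?row i" if i: "i < n" for i
    proof -
      have "(a(n := 0)) i = (\<Sum>j<Suc n. (T i j - T j i) * f j)"
        using i by (intro T[rule_format]) simp
      then show ?thesis using i by (simp add: mult.commute)
    qed
    moreover have "?k \<in> Collect (koszul_syzygy n f)"
      unfolding koszul_syzygy_def by blast
    ultimately show "\<exists>k\<in>Collect (koszul_syzygy n f). \<exists>row. (\<forall>l\<in>{n}. row l \<in> Collect (syzygy n f))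
        \<and> (\<forall>i<n. a i = k i + (\<Sum>l\<in>{n}. f l * row l i))"
      by (intro bexI[of _ ?k] exI[of _ "\<lambda>_. ?row"]) simp_all
  qed (use that f pos in \<open>auto intro: koszul_syzygy_zero koszul_syzygy_add koszul_syzygy_mult
      koszul_syzygy_hom_part koszul_syzygy_cong\<close>)
  then show ?thesis by (simp add: koszul_acyclic_def)
qed

lemma koszul_acyclic_imp_nonzerodivisor_chain:
  assumes "\<And>i. i < n \<Longrightarrow> f i \<in> homogeneous_part (D i)" "\<And>i. i < n \<Longrightarrow> 0 < D i"
    and "koszul_acyclic n f"
  shows "nonzerodivisor_chain n f"
  using assms
proof (induction n)
  case 0
  then show ?case by (simp add: nonzerodivisor_chain_def)
next
  case (Suc n)
  then have "koszul_acyclic n f" by (intro koszul_acyclic_prefix[of n f D]) simp_all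
  then have "nonzerodivisor_chain n f" using Suc by simp
  then show ?case
    using koszul_acyclic_Suc_nonzerodivisor[OF Suc.prems(3)]
    by (auto simp: nonzerodivisor_chain_def less_Suc_eq)
qed

lemma max_idealE:
  fixes p :: "('n::finite, 'k::comm_ring_1) mpoly"
  assumes "p \<in> max_ideal"
  obtains q where "p = (\<Sum>v\<in>UNIV. Var v * q v)"
proof -
  have "\<exists>q. p = (\<Sum>v\<in>UNIV. Var v * q v)"
    using assms unfolding max_ideal_def ideal_gen_def
  proof (induction rule: module.span_induct_alt[OF module_self, consumes 1, case_names base step])
    case base
    show ?case by (rule exI[of _ "\<lambda>_. 0"]) simp
  next
    case (step c x y)
    then obtain w q where "x = Var w" "y = (\<Sum>v\<in>UNIV. Var v * q v)" by blast
    moreover have "(\<Sum>v\<in>UNIV. Var v * (if v = w then c else 0)) = c * Var w"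
      by (simp add: if_distrib[of "\<lambda>x. _ * x"] mult.commute cong: if_cong)
    ultimately show ?case
      by (intro exI[of _ "\<lambda>v. (if v = w then c else 0) + q v"]) (simp add: distrib_left sum.distrib)
  qed
  then show ?thesis using that by blast
qed

lemma ideal_mult_max_idealE:
  fixes J :: "('n::finite, 'k::comm_ring_1) mpoly set"
  assumes J: "ring_ideal J" and "x \<in> ideal_mult max_ideal J"
  obtains b where "\<forall>v. b v \<in> J" "x = (\<Sum>v\<in>UNIV. Var v * b v)"
proof -
  have "\<exists>b. (\<forall>v. b v \<in> J) \<and> x = (\<Sum>v\<in>UNIV. Var v * b v)"
    using assms(2) unfolding ideal_mult_def ideal_gen_def
  proof (induction rule: module.span_induct_alt[OF module_self, consumes 1, case_names base step])
    case base
    show ?case by (rule exI[of _ "\<lambda>_. 0"]) (simp add: ring_ideal_zero[OF J])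
  next
    case (step c x y)
    then obtain p g b where x: "x = p * g" "p \<in> max_ideal" "g \<in> J"
      and b: "\<And>v. b v \<in> J" "y = (\<Sum>v\<in>UNIV. Var v * b v)" by blast
    obtain q where q: "p = (\<Sum>v\<in>UNIV. Var v * q v)" using max_idealE[OF x(2)] .
    have "c * x + y = (\<Sum>v\<in>UNIV. Var v * (c * q v * g + b v))"
      by (simp add: x b(2) q sum_distrib_left sum_distrib_right distrib_left sum.distrib mult_ac)
    moreover have "c * q v * g + b v \<in> J" for v
      using J x(3) b(1) by (intro ring_ideal_add ring_ideal_mult)
    ultimately show ?case by (intro exI[of _ "\<lambda>v. c * q v * g + b v"]) simp
  qed
  then show ?thesis using that by blast
qed

lemma ring_ideal_ideal_mult: "ring_ideal (ideal_mult P J)"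
  unfolding ideal_mult_def by (rule ring_ideal_ideal_gen)

lemma ideal_mult_base: "p \<in> P \<Longrightarrow> g \<in> J \<Longrightarrow> p * g \<in> ideal_mult P J"
  unfolding ideal_mult_def by (rule ideal_gen_base) blast

lemma poly_mapping_sum_single:
  "f = (\<Sum>a\<in>Poly_Mapping.keys f. Poly_Mapping.single a (Poly_Mapping.lookup f a))"
proof (rule poly_mapping_eqI)
  fix b
  have "Poly_Mapping.lookup (\<Sum>a\<in>Poly_Mapping.keys f.
      Poly_Mapping.single a (Poly_Mapping.lookup f a)) b =
    (\<Sum>a\<in>Poly_Mapping.keys f. if a = b then Poly_Mapping.lookup f b else 0)"
    unfolding lookup_sum by (rule sum.cong) (auto simp: lookup_single when_def)
  then show "Poly_Mapping.lookup f b = Poly_Mapping.lookup (\<Sum>a\<in>Poly_Mapping.keys f.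
      Poly_Mapping.single a (Poly_Mapping.lookup f a)) b"
    by (simp add: in_keys_iff)
qed

lemma minus_constant_term_mem_max_ideal:
  fixes f :: "('n, 'k::comm_ring_1) mpoly"
  shows "f - Const (Poly_Mapping.lookup f 0) \<in> max_ideal"
proof -
  have ideal: "ring_ideal (max_ideal :: ('n, 'k) mpoly set)"
    unfolding max_ideal_def by (rule ring_ideal_ideal_gen)
  have monom: "Poly_Mapping.single a c \<in> max_ideal" if "a \<noteq> 0" for a :: "'n \<Rightarrow>\<^sub>0 nat" and c :: 'k
  proof -
    obtain i where "Poly_Mapping.lookup a i \<noteq> 0"
      using \<open>a \<noteq> 0\<close> by (metis lookup_zero poly_mapping_eqI)
    then have "Poly_Mapping.single i 1 + (a - Poly_Mapping.single i 1) = a"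
      by (intro poly_mapping_eqI) (auto simp: lookup_add lookup_minus lookup_single when_def)
    then have "Poly_Mapping.single a c = Poly_Mapping.single (a - Poly_Mapping.single i 1) c * Var i"
      by (simp add: Var_def mult_single add.commute)
    then show ?thesis
      using ideal by (simp add: max_ideal_def ideal_gen_base ring_ideal_mult)
  qed
  let ?g = "f - Const (Poly_Mapping.lookup f 0)"
  have "Poly_Mapping.single a (Poly_Mapping.lookup ?g a) \<in> max_ideal" for a
    by (cases "a = 0")
      (simp_all add: monom lookup_minus Const_def ring_ideal_zero[OF ideal])
  then have "(\<Sum>a\<in>Poly_Mapping.keys ?g. Poly_Mapping.single a (Poly_Mapping.lookup ?g a)) \<in> max_ideal"
    using ideal by (intro ring_ideal_sum)
  then show ?thesis by (simp flip: poly_mapping_sum_single)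
qed

text \<open>A lift of a basis of \<open>I / \<mm> I\<close>, with the degrees of its members.\<close>

definition minimal_generators ::
    "('n::finite, 'k::comm_ring_1) mpoly set \<Rightarrow> nat \<Rightarrow> (nat \<Rightarrow> nat) \<Rightarrow> (nat \<Rightarrow> ('n, 'k) mpoly) \<Rightarrow> bool"
  where "minimal_generators I s D f \<longleftrightarrow>
    (\<forall>i<s. f i \<in> I \<and> f i \<in> homogeneous_part (D i))
    \<and> (\<forall>g\<in>I. \<exists>l. g - (\<Sum>i<s. Const (l i) * f i) \<in> ideal_mult max_ideal I)
    \<and> (\<forall>l. (\<Sum>i<s. Const (l i) * f i) \<in> ideal_mult max_ideal I \<longrightarrow> (\<forall>i<s. l i = 0))"

lemma minimal_generatorsD:
  assumes "minimal_generators I s D f"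
  shows minimal_generators_mem: "i < s \<Longrightarrow> f i \<in> I"
    and minimal_generators_homogeneous: "i < s \<Longrightarrow> f i \<in> homogeneous_part (D i)"
    and minimal_generators_independent:
      "(\<Sum>i<s. Const (l i) * f i) \<in> ideal_mult max_ideal I \<Longrightarrow> i < s \<Longrightarrow> l i = 0"
  using assms by (auto simp: minimal_generators_def)

text \<open>Nakayama's lemma for tuples of length 1.\<close>

lemma minimal_generators_generate:
  assumes I: "graded_ideal I" and f: "minimal_generators I s D f"
  shows "ideal_gen (f ` {..<s}) = I"
proof
  have ideal: "ring_ideal I" using I by (simp add: graded_ideal_def)
  show "ideal_gen (f ` {..<s}) \<subseteq> I"
    using f ideal by (intro ideal_gen_subset) (auto simp: minimal_generators_def)
  let ?J = "ideal_gen (f ` {..<s})"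
  have J: "graded_ideal ?J"
    using f by (intro graded_ideal_ideal_gen) (auto simp: minimal_generators_def)
  then have J': "ring_ideal ?J" and J_hom: "\<And>x k. x \<in> ?J \<Longrightarrow> hom_part k x \<in> ?J"
    by (simp_all add: graded_ideal_def)
  show "I \<subseteq> ?J"
  proof
    fix g assume g: "g \<in> I"
    have "(\<lambda>_. g) \<in> {a. a (0::nat) \<in> ?J}"
    proof (rule graded_nakayama[where M = "{a. a 0 \<in> I}" and L = UNIV and h = Var
          and \<delta> = "\<lambda>_. 1" and D = "\<lambda>_. 0" and s = 1])
      fix a :: "nat \<Rightarrow> ('a, 'b) mpoly" assume "a \<in> {a. a 0 \<in> I}"
      then obtain l where l: "a 0 - (\<Sum>i<s. Const (l i) * f i) \<in> ideal_mult max_ideal I"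
        using f by (auto simp: minimal_generators_def)
      obtain b where b: "\<forall>v. b v \<in> I"
        "a 0 - (\<Sum>i<s. Const (l i) * f i) = (\<Sum>v\<in>UNIV. Var v * b v)"
        by (rule ideal_mult_max_idealE[OF ideal l]) blast
      have "(\<Sum>i<s. Const (l i) * f i) \<in> ?J"
        unfolding mem_ideal_gen_image_lessThan by (rule exI[of _ "\<lambda>i. Const (l i)"]) simp
      then show "\<exists>k\<in>{a. a 0 \<in> ?J}. \<exists>n. (\<forall>v\<in>UNIV. n v \<in> {a. a 0 \<in> I})
          \<and> (\<forall>i<1. a i = k i + (\<Sum>v\<in>UNIV. Var v * n v i))"
        using b by (intro bexI[of _ "\<lambda>_. \<Sum>i<s. Const (l i) * f i"] exI[of _ "\<lambda>v _. b v"])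
          (auto simp: algebra_simps)
    qed (use J_hom g Var_homogeneous in \<open>auto
        intro: ring_ideal_zero[OF J'] ring_ideal_add[OF J'] ring_ideal_mult[OF J']\<close>)
    then show "g \<in> ?J" by simp
  qed
qed

text \<open>
  The constant terms of the coefficients form a linear relation modulo \<open>\<mm> I\<close>, which is trivial.
\<close>

lemma minimal_generators_syzygy_coefficient:
  assumes I: "ring_ideal I" and f: "minimal_generators I s D f" and a: "syzygy s f a" and i: "i < s"
  shows "a i \<in> max_ideal"
proof -
  let ?l = "\<lambda>i. Poly_Mapping.lookup (a i) 0"
  have "(\<Sum>i<s. (a i - Const (?l i)) * f i) \<in> ideal_mult max_ideal I"
    using f by (intro ring_ideal_sum[OF ring_ideal_ideal_mult] ideal_mult_base
        minus_constant_term_mem_max_ideal) (simp add: minimal_generators_def)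
  moreover have "(\<Sum>i<s. (a i - Const (?l i)) * f i) = - (\<Sum>i<s. Const (?l i) * f i)"
    using a by (simp add: syzygy_def left_diff_distrib sum_subtractf)
  ultimately have "- (\<Sum>i<s. Const (?l i) * f i) \<in> ideal_mult max_ideal I"
    by simp
  from ring_ideal_neg[OF ring_ideal_ideal_mult this]
  have "(\<Sum>i<s. Const (?l i) * f i) \<in> ideal_mult max_ideal I" by simp
  then have "?l i = 0" using i by (rule minimal_generators_independent[OF f])
  then show ?thesis using minus_constant_term_mem_max_ideal[of "a i"] by (simp add: Const_zero)
qed

text \<open>
  The regular sequence that generates \<open>I\<close> need not consist of homogeneous elements, and only
  locally at \<open>\<mm>\<close> is it related to \<open>f\<close> by an invertible matrix.  Comparing syzygies is enough:
  a syzygy of \<open>f\<close> is Koszul up to a combination of syzygies with coefficients in \<open>\<mm>\<close>.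
\<close>

lemma minimal_generators_koszul_acyclic:
  fixes I :: "('n::finite, 'k::comm_ring_1) mpoly set"
  assumes I: "graded_ideal I" and f: "minimal_generators I s D f"
    and g: "nonzerodivisor_chain r g" "ideal_gen (g ` {..<r}) = I"
  shows "koszul_acyclic s f"
proof -
  have ideal: "ring_ideal I" using I by (simp add: graded_ideal_def)
  note gen = minimal_generators_generate[OF I f]
  have hom: "f i \<in> homogeneous_part (D i)" if "i < s" for i
    using f that by (simp add: minimal_generators_def)
  have "a \<in> Collect (koszul_syzygy s f)" if "a \<in> Collect (syzygy s f)" for a
  proof (rule graded_nakayama[where M = "Collect (syzygy s f)" and L = UNIV and h = Var
        and \<delta> = "\<lambda>_. 1" and D = D and s = s])
    fix a assume "a \<in> Collect (syzygy s f)"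
    then have a: "syzygy s f a" by simp
    obtain k row where k: "koszul_syzygy s f k" and row: "\<And>i. i < s \<Longrightarrow> syzygy s f (row i)"
      and eq: "\<And>j. j < s \<Longrightarrow> a j = k j + (\<Sum>i<s. a i * row i j)"
    proof (rule syzygy_change_of_generators[where f = f and s = s and g = g and r = r and a = a])
      show "f i \<in> ideal_gen (g ` {..<r})" if "i < s" for i
        unfolding g(2) gen[symmetric] using that by (intro ideal_gen_base) auto
      show "g l \<in> ideal_gen (f ` {..<s})" if "l < r" for l
        unfolding gen g(2)[symmetric] using that by (intro ideal_gen_base) auto
    qed (use a syzygy_imp_koszul_syzygy[OF g(1)] in auto)
    have "\<exists>q. a i = (\<Sum>v\<in>UNIV. Var v * q v)" if "i < s" for i
      by (rule max_idealE[OF minimal_generators_syzygy_coefficient[OF ideal f a that]]) blast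
    then obtain q where q: "\<And>i. i < s \<Longrightarrow> a i = (\<Sum>v\<in>UNIV. Var v * q i v)" by metis
    let ?n = "\<lambda>v j. \<Sum>i<s. q i v * row i j"
    have "(\<Sum>j<s. ?n v j * f j) = (\<Sum>i<s. q i v * (\<Sum>j<s. row i j * f j))" for v
      unfolding sum_distrib_left sum_distrib_right by (subst sum.swap) (simp add: mult.assoc)
    then have "syzygy s f (?n v)" for v
      using row by (simp add: syzygy_def)
    moreover have "a j = k j + (\<Sum>v\<in>UNIV. Var v * ?n v j)" if "j < s" for j
    proof -
      have "(\<Sum>i<s. a i * row i j) = (\<Sum>i<s. (\<Sum>v\<in>UNIV. Var v * q i v) * row i j)"
        using q by simp
      also have "\<dots> = (\<Sum>v\<in>UNIV. Var v * ?n v j)"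
        unfolding sum_distrib_left sum_distrib_right by (subst sum.swap) (simp add: mult.assoc)
      finally show ?thesis using eq[OF that] by simp
    qed
    ultimately show "\<exists>k\<in>Collect (koszul_syzygy s f). \<exists>n. (\<forall>v\<in>UNIV. n v \<in> Collect (syzygy s f))
        \<and> (\<forall>j<s. a j = k j + (\<Sum>v\<in>UNIV. Var v * n v j))"
      using k by (intro bexI[of _ k] exI[of _ ?n]) simp_all
  qed (use that hom Var_homogeneous in \<open>auto intro: koszul_syzygy_zero koszul_syzygy_add
      koszul_syzygy_mult koszul_syzygy_hom_part koszul_syzygy_cong\<close>)
  then show ?thesis by (simp add: koszul_acyclic_def)
qed

text \<open>A generator of degree 0 would be a nonzero constant, making \<open>I\<close> the whole ring.\<close>

lemma minimal_generators_positive_degree: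
  fixes I :: "('n::finite, 'k::field) mpoly set"
  assumes I: "ring_ideal I" "I \<noteq> UNIV" and f: "minimal_generators I s D f" and i: "i < s"
  shows "0 < D i"
proof (rule ccontr)
  assume "\<not> 0 < D i"
  moreover have "f i \<in> homogeneous_part (D i)" using f i by (simp add: minimal_generators_def)
  ultimately have hom: "f i \<in> homogeneous_part 0" by simp
  let ?c = "Poly_Mapping.lookup (f i) 0"
  have "monom_degree b \<noteq> 0" if "b \<noteq> 0" for b :: "'n \<Rightarrow>\<^sub>0 nat"
    using that by (simp add: monom_degree_def poly_mapping_eq_iff fun_eq_iff)
  then have const: "f i = Const ?c"
    using hom by (intro poly_mapping_eqI)
      (auto simp: Const_def lookup_single when_def mem_homogeneous_part_iff)
  have "(\<Sum>j<s. Const (if j = i then 1 else 0) * f j) = (\<Sum>j<s. if j = i then f j else 0)"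
    by (rule sum.cong) (auto simp: Const_zero Const_one)
  also have "\<dots> = f i" using i by simp
  finally have sum: "(\<Sum>j<s. Const (if j = i then 1 else 0) * f j) = f i" .
  have "?c \<noteq> 0"
  proof
    assume "?c = 0"
    then have "f i = 0" using const by (metis Const_zero)
    then have "(\<Sum>j<s. Const (if j = i then 1 else 0) * f j) \<in> ideal_mult max_ideal I"
      unfolding sum by (simp add: ring_ideal_zero[OF ring_ideal_ideal_mult])
    from minimal_generators_independent[OF f this i] show False by simp
  qed
  then have "1 = Const (inverse ?c) * f i"
    using const by (metis Const_mult Const_one left_inverse)
  then have "1 \<in> I"
    using ring_ideal_mult[OF I(1) minimal_generators_mem[OF f i]] by metis
  then have "x * 1 \<in> I" for x using I(1) by (intro ring_ideal_mult)
  then show False using I(2) by auto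
qed

lemma minimal_generators_nonzerodivisor_chain:
  fixes I :: "('n::finite, 'k::field) mpoly set"
  assumes I: "graded_ideal I" "complete_intersection_ideal I" and f: "minimal_generators I s D f"
  shows "nonzerodivisor_chain s f"
proof -
  obtain gs where gs: "regular_sequence gs" "I = ideal_gen (set gs)"
    using I(2) by (auto simp: complete_intersection_ideal_def)
  have take: "set (take i gs) = (!) gs ` {..<i}" if "i \<le> length gs" for i
    using nth_image[OF that] by (simp add: atLeast0LessThan)
  have "nonzerodivisor_chain (length gs) ((!) gs)"
    using gs(1) take by (simp add: regular_sequence_def nonzerodivisor_chain_def)
  moreover have "ideal_gen ((!) gs ` {..<length gs}) = I" using gs(2) take[of "length gs"] by simp
  ultimately have "koszul_acyclic s f" by (rule minimal_generators_koszul_acyclic[OF I(1) f])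
  moreover have "I \<noteq> UNIV" using gs by (simp add: regular_sequence_def)
  ultimately show ?thesis
    using f minimal_generators_positive_degree[OF _ _ f] I(1)
    by (intro koszul_acyclic_imp_nonzerodivisor_chain[of s f D])
      (auto simp: minimal_generators_def graded_ideal_def)
qed

section \<open>Traces on subquotients of a vector space\<close>

locale subquotients = vector_space scale
  for scale :: "'a::field \<Rightarrow> 'b::ab_group_add \<Rightarrow> 'b" (infixr \<open>*s\<close> 75)
begin

text \<open>
  The quotient \<open>U / W\<close> is never formed: a basis of it is a family of representatives in \<open>U\<close>.
  In general this describes \<open>U / (U \<inter> W)\<close>; taking for \<open>U\<close> the forms of degree \<open>e\<close> and for \<open>W\<close> a
  homogeneous ideal gives the degree \<open>e\<close> part of the quotient ring.
\<close>

definition rel_basis :: "'b set \<Rightarrow> 'b set \<Rightarrow> 'i set \<Rightarrow> ('i \<Rightarrow> 'b) \<Rightarrow> bool" where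
  "rel_basis U W A b \<longleftrightarrow> finite A \<and> b ` A \<subseteq> U
     \<and> (\<forall>u\<in>U. \<exists>c. u - (\<Sum>i\<in>A. c i *s b i) \<in> W)
     \<and> (\<forall>c. (\<Sum>i\<in>A. c i *s b i) \<in> W \<longrightarrow> (\<forall>i\<in>A. c i = 0))"

definition rel_matrix :: "'b set \<Rightarrow> 'i set \<Rightarrow> ('i \<Rightarrow> 'b) \<Rightarrow> ('b \<Rightarrow> 'b) \<Rightarrow> ('i \<Rightarrow> 'i \<Rightarrow> 'a) \<Rightarrow> bool" where
  "rel_matrix W A b T M \<longleftrightarrow> (\<forall>i\<in>A. T (b i) - (\<Sum>j\<in>A. M i j *s b j) \<in> W)"

definition rel_trace :: "'b set \<Rightarrow> 'b set \<Rightarrow> ('b \<Rightarrow> 'b) \<Rightarrow> 'a" where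
  "rel_trace U W T = (SOME t. \<exists>(n::nat) b M. rel_basis U W {..<n} b \<and> rel_matrix W {..<n} b T M
     \<and> t = (\<Sum>i<n. M i i))"

lemma rel_basisD:
  assumes "rel_basis U W A b"
  shows rel_basis_finite: "finite A" and rel_basis_mem: "i \<in> A \<Longrightarrow> b i \<in> U"
    and rel_basis_span: "u \<in> U \<Longrightarrow> \<exists>c. u - (\<Sum>i\<in>A. c i *s b i) \<in> W"
    and rel_basis_independent: "(\<Sum>i\<in>A. c i *s b i) \<in> W \<Longrightarrow> i \<in> A \<Longrightarrow> c i = 0"
  using assms unfolding rel_basis_def by blast+

lemma rel_basis_unique:
  assumes W: "subspace W" and b: "rel_basis U W A b"
    and c: "u - (\<Sum>i\<in>A. c i *s b i) \<in> W" and d: "u - (\<Sum>i\<in>A. d i *s b i) \<in> W" and i: "i \<in> A"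
  shows "c i = d i"
proof -
  have "(u - (\<Sum>i\<in>A. d i *s b i)) - (u - (\<Sum>i\<in>A. c i *s b i)) \<in> W"
    by (rule subspace_diff[OF W d c])
  also have "(u - (\<Sum>i\<in>A. d i *s b i)) - (u - (\<Sum>i\<in>A. c i *s b i)) = (\<Sum>i\<in>A. (c i - d i) *s b i)"
    by (simp add: scale_left_diff_distrib sum_subtractf)
  finally have "c i - d i = 0" using i by (rule rel_basis_independent[OF b])
  then show ?thesis by simp
qed

lemma sum_scale_cong_mod:
  assumes W: "subspace W" and xy: "\<And>i. i \<in> A \<Longrightarrow> x i - y i \<in> W"
  shows "(\<Sum>i\<in>A. c i *s x i) - (\<Sum>i\<in>A. c i *s y i) \<in> W"
proof -
  have "(\<Sum>i\<in>A. c i *s (x i - y i)) \<in> W"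
    using W xy by (intro subspace_sum subspace_scale)
  then show ?thesis by (simp add: scale_right_diff_distrib sum_subtractf)
qed

lemma cong_mod_trans:
  assumes W: "subspace W" and "x - y \<in> W" "y - z \<in> W"
  shows "x - z \<in> W"
  using subspace_add[OF W assms(2,3)] by simp

lemma sum_scale_sum_scale:
  "(\<Sum>i\<in>A. c i *s (\<Sum>j\<in>B. M i j *s b j)) = (\<Sum>j\<in>B. (\<Sum>i\<in>A. c i * M i j) *s b j)"
  by (simp add: scale_sum_right scale_sum_left sum.swap[of _ A B])

text \<open>
  With base change matrices \<open>P\<close> and \<open>Q\<close> the second matrix is \<open>P M Q\<close> and \<open>Q P = 1\<close>, so the
  traces agree by cyclic invariance.
\<close>

lemma trace_basis_independent:
  fixes b :: "'i \<Rightarrow> 'b" and b' :: "'j \<Rightarrow> 'b"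
  assumes W: "subspace W" and T: "module_hom scale scale T" "\<And>w. w \<in> W \<Longrightarrow> T w \<in> W"
    and b: "rel_basis U W A b" "rel_matrix W A b T M"
    and b': "rel_basis U W B b'" "rel_matrix W B b' T M'"
  shows "(\<Sum>i\<in>A. M i i) = (\<Sum>i\<in>B. M' i i)"
proof -
  have "\<forall>i\<in>B. \<exists>c. b' i - (\<Sum>j\<in>A. c j *s b j) \<in> W"
    using rel_basis_span[OF b(1)] rel_basis_mem[OF b'(1)] by blast
  then obtain P where P: "\<And>i. i \<in> B \<Longrightarrow> b' i - (\<Sum>j\<in>A. P i j *s b j) \<in> W" by metis
  have "\<forall>j\<in>A. \<exists>c. b j - (\<Sum>i\<in>B. c i *s b' i) \<in> W"
    using rel_basis_span[OF b'(1)] rel_basis_mem[OF b(1)] by blast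
  then obtain Q where Q: "\<And>j. j \<in> A \<Longrightarrow> b j - (\<Sum>i\<in>B. Q j i *s b' i) \<in> W" by metis
  have QP: "(\<Sum>i\<in>B. Q j i * P i k) = (if k = j then 1 else 0)" if jk: "j \<in> A" "k \<in> A" for j k
  proof (rule rel_basis_unique[OF W b(1) _ _ jk(2)])
    show "b j - (\<Sum>k\<in>A. (\<Sum>i\<in>B. Q j i * P i k) *s b k) \<in> W"
      unfolding sum_scale_sum_scale[symmetric]
      by (rule cong_mod_trans[OF W Q[OF jk(1)] sum_scale_cong_mod[OF W P]])
    have "(\<Sum>k\<in>A. (if k = j then 1 else 0) *s b k) = (\<Sum>k\<in>A. if k = j then b k else 0)"
      by (rule sum.cong) auto
    then show "b j - (\<Sum>k\<in>A. (if k = j then 1 else 0) *s b k) \<in> W"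
      using jk rel_basis_finite[OF b(1)] by (simp add: subspace_0[OF W])
  qed
  have PMQ: "M' i l = (\<Sum>k\<in>A. (\<Sum>j\<in>A. P i j * M j k) * Q k l)" if il: "i \<in> B" "l \<in> B" for i l
  proof (rule rel_basis_unique[OF W b'(1) _ _ il(2)])
    show "T (b' i) - (\<Sum>l\<in>B. M' i l *s b' l) \<in> W"
      using b'(2) il by (simp add: rel_matrix_def)
    have "T (b' i - (\<Sum>j\<in>A. P i j *s b j)) \<in> W" by (rule T(2)[OF P[OF il(1)]])
    then have "T (b' i) - (\<Sum>j\<in>A. P i j *s T (b j)) \<in> W"
      by (simp add: module_hom.diff[OF T(1)] module_hom.sum[OF T(1)] module_hom.scale[OF T(1)])
    moreover have "(\<Sum>j\<in>A. P i j *s T (b j)) - (\<Sum>j\<in>A. P i j *s (\<Sum>k\<in>A. M j k *s b k)) \<in> W"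
      using b(2) by (intro sum_scale_cong_mod[OF W]) (simp add: rel_matrix_def)
    moreover have "(\<Sum>k\<in>A. (\<Sum>j\<in>A. P i j * M j k) *s b k)
        - (\<Sum>k\<in>A. (\<Sum>j\<in>A. P i j * M j k) *s (\<Sum>l\<in>B. Q k l *s b' l)) \<in> W"
      using Q by (intro sum_scale_cong_mod[OF W])
    ultimately show "T (b' i) - (\<Sum>l\<in>B. (\<Sum>k\<in>A. (\<Sum>j\<in>A. P i j * M j k) * Q k l) *s b' l) \<in> W"
      unfolding sum_scale_sum_scale by (blast intro: cong_mod_trans[OF W])
  qed
  have "(\<Sum>i\<in>B. M' i i) = (\<Sum>i\<in>B. \<Sum>k\<in>A. \<Sum>j\<in>A. M j k * (Q k i * P i j))"
    using PMQ by (simp add: sum_distrib_left sum_distrib_right mult_ac)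
  also have "\<dots> = (\<Sum>k\<in>A. \<Sum>j\<in>A. \<Sum>i\<in>B. M j k * (Q k i * P i j))"
    by (subst sum.swap, rule sum.cong[OF refl], subst sum.swap) simp
  also have "\<dots> = (\<Sum>k\<in>A. \<Sum>j\<in>A. if j = k then M j k else 0)"
    by (intro sum.cong refl) (simp add: QP flip: sum_distrib_left)
  also have "\<dots> = (\<Sum>k\<in>A. M k k)"
    using rel_basis_finite[OF b(1)] by simp
  finally show ?thesis by simp
qed

lemma rel_basis_reindex:
  assumes h: "bij_betw h A' A" and b: "rel_basis U W A b"
  shows "rel_basis U W A' (b \<circ> h)"
proof -
  have sum: "(\<Sum>i\<in>A'. c i *s b (h i)) = (\<Sum>i\<in>A. c (inv_into A' h i) *s b i)" for c
  proof -
    have "(\<Sum>i\<in>A. c (inv_into A' h i) *s b i) =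
        (\<Sum>i\<in>A'. c (inv_into A' h (h i)) *s b (h i))"
      by (rule sum.reindex_bij_betw[OF h, symmetric])
    also have "\<dots> = (\<Sum>i\<in>A'. c i *s b (h i))"
      using h by (intro sum.cong refl) (simp add: bij_betw_def)
    finally show ?thesis by simp
  qed
  have "\<exists>c. u - (\<Sum>i\<in>A'. c i *s b (h i)) \<in> W" if u: "u \<in> U" for u
  proof -
    obtain c where c: "u - (\<Sum>i\<in>A. c i *s b i) \<in> W" using rel_basis_span[OF b u] by blast
    have "(\<Sum>i\<in>A'. c (h i) *s b (h i)) = (\<Sum>i\<in>A. c i *s b i)"
      by (rule sum.reindex_bij_betw[OF h])
    with c show ?thesis by metis
  qed
  moreover have "c i = 0" if c: "(\<Sum>i\<in>A'. c i *s b (h i)) \<in> W" and i: "i \<in> A'" for c i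
  proof -
    have "c (inv_into A' h (h i)) = 0"
    proof (rule rel_basis_independent[OF b c[unfolded sum]])
      show "h i \<in> A" using h i by (auto simp: bij_betw_def)
    qed
    then show ?thesis using h i by (simp add: bij_betw_def)
  qed
  moreover have "finite A'" "(b \<circ> h) ` A' \<subseteq> U"
    using rel_basis_finite[OF b] rel_basis_mem[OF b] h bij_betw_finite[OF h]
    by (auto simp: bij_betw_def)
  ultimately show ?thesis unfolding rel_basis_def o_def by blast
qed

lemma rel_basis_lessThan:
  assumes b: "rel_basis U W A b"
  obtains n :: nat and b' where "rel_basis U W {..<n} b'"
proof -
  obtain h where "bij_betw h {0..<card A} A"
    using ex_bij_betw_nat_finite[OF rel_basis_finite[OF b]] by blast
  then have "rel_basis U W {0..<card A} (b \<circ> h)" by (rule rel_basis_reindex[OF _ b])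
  then show ?thesis using that by (simp add: atLeast0LessThan)
qed

lemma rel_matrix_exists:
  assumes b: "rel_basis U W A b" and T: "\<And>u. u \<in> U \<Longrightarrow> T u \<in> U"
  obtains M where "rel_matrix W A b T M"
proof -
  have "\<forall>i\<in>A. \<exists>c. T (b i) - (\<Sum>j\<in>A. c j *s b j) \<in> W"
    using rel_basis_span[OF b] T rel_basis_mem[OF b] by blast
  then obtain M where "\<And>i. i \<in> A \<Longrightarrow> T (b i) - (\<Sum>j\<in>A. M i j *s b j) \<in> W" by metis
  then show ?thesis using that unfolding rel_matrix_def by blast
qed

lemma rel_trace_eq:
  assumes W: "subspace W" and T: "module_hom scale scale T" "\<And>w. w \<in> W \<Longrightarrow> T w \<in> W"
      "\<And>u. u \<in> U \<Longrightarrow> T u \<in> U"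
    and b: "rel_basis U W A b" "rel_matrix W A b T M"
  shows "rel_trace U W T = (\<Sum>i\<in>A. M i i)"
proof -
  obtain n :: nat and b' where b': "rel_basis U W {..<n} b'" using rel_basis_lessThan[OF b(1)] .
  obtain M' where M': "rel_matrix W {..<n} b' T M'" using rel_matrix_exists[OF b' T(3)] .
  have "\<exists>(n::nat) b M. rel_basis U W {..<n} b \<and> rel_matrix W {..<n} b T M
     \<and> rel_trace U W T = (\<Sum>i<n. M i i)"
    unfolding rel_trace_def by (rule someI[of _ "\<Sum>i<n. M' i i"]) (use b' M' in blast)
  then show ?thesis using trace_basis_independent[OF W T(1,2) _ _ b] by metis
qed

text \<open>A spanning set of least cardinality is a basis.\<close>

lemma rel_basis_exists:
  assumes W: "subspace W" and S: "finite S" "S \<subseteq> U" "U \<subseteq> span S"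
  obtains n :: nat and b where "rel_basis U W {..<n} b"
proof -
  define spans where "spans B \<longleftrightarrow> finite B \<and> B \<subseteq> U \<and>
    (\<forall>u\<in>U. \<exists>c. u - (\<Sum>v\<in>B. c v *s v) \<in> W)" for B
  have "spans S"
    unfolding spans_def
  proof (intro conjI S ballI)
    fix u assume "u \<in> U"
    then obtain c where "u = (\<Sum>v\<in>S. c v *s v)" using S span_finite[OF S(1)] by auto
    then show "\<exists>c. u - (\<Sum>v\<in>S. c v *s v) \<in> W"
      using subspace_0[OF W] by (intro exI[of _ c]) simp
  qed
  then obtain B where B: "spans B" and minimal: "\<And>B'. spans B' \<Longrightarrow> card B \<le> card B'"
    using ex_has_least_nat[of spans S card] by blast
  have fin: "finite B" using B by (simp add: spans_def)
  have "c v0 = 0" if c: "(\<Sum>v\<in>B. c v *s v) \<in> W" and v0: "v0 \<in> B" for c v0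
  proof (rule ccontr)
    assume nz: "c v0 \<noteq> 0"
    \<comment> \<open>the relation expresses \<open>v0\<close> through the other elements, which then span already\<close>
    have "\<exists>e. u - (\<Sum>v\<in>B - {v0}. e v *s v) \<in> W" if u: "u \<in> U" for u
    proof -
      obtain d where d: "u - (\<Sum>v\<in>B. d v *s v) \<in> W" using B u by (auto simp: spans_def)
      let ?r = "d v0 / c v0"
      have "(u - (\<Sum>v\<in>B. d v *s v)) + ?r *s (\<Sum>v\<in>B. c v *s v) \<in> W"
        using W d c by (intro subspace_add subspace_scale)
      also have "(u - (\<Sum>v\<in>B. d v *s v)) + ?r *s (\<Sum>v\<in>B. c v *s v) =
          u - (\<Sum>v\<in>B. (d v - ?r * c v) *s v)"
        by (simp add: scale_left_diff_distrib sum_subtractf scale_sum_right)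
      also have "(\<Sum>v\<in>B. (d v - ?r * c v) *s v) = (\<Sum>v\<in>B - {v0}. (d v - ?r * c v) *s v)"
        using nz fin v0 by (subst sum.remove[OF fin v0]) simp
      finally show ?thesis by (rule exI[of _ "\<lambda>v. d v - ?r * c v"])
    qed
    then have "spans (B - {v0})" using B by (auto simp: spans_def)
    from minimal[OF this] show False using fin v0 by (metis card_Diff1_less not_le)
  qed
  then have "rel_basis U W B id"
    using B by (auto simp: rel_basis_def spans_def)
  then show ?thesis using that by (rule rel_basis_lessThan)
qed

text \<open>
  Additivity along the filtration \<open>W\<^sub>1 \<subseteq> W\<^sub>2\<close>: in the concatenated basis the matrix is block
  triangular.
\<close>

lemma rel_trace_additive:
  fixes b1 :: "'i \<Rightarrow> 'b" and b2 :: "'j \<Rightarrow> 'b"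
  assumes U: "subspace U" and W: "subspace W1" "subspace W2" "W1 \<subseteq> W2"
    and T: "module_hom scale scale T" "\<And>w. w \<in> W1 \<Longrightarrow> T w \<in> W1" "\<And>w. w \<in> W2 \<Longrightarrow> T w \<in> W2"
      "\<And>u. u \<in> U \<Longrightarrow> T u \<in> U"
    and b1: "rel_basis (U \<inter> W2) W1 A b1" and b2: "rel_basis U W2 B b2"
  shows "rel_trace U W1 T = rel_trace (U \<inter> W2) W1 T + rel_trace U W2 T"
proof -
  obtain M1 where M1: "rel_matrix W1 A b1 T M1"
    using rel_matrix_exists[OF b1] T by (metis IntE IntI)
  obtain M2 where M2: "rel_matrix W2 B b2 T M2" using rel_matrix_exists[OF b2 T(4)] .
  have fin: "finite A" "finite B" using rel_basis_finite b1 b2 by blast+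
  define b where "b = case_sum b1 b2"
  have sum_b: "(\<Sum>k\<in>A <+> B. c k *s b k) =
      (\<Sum>i\<in>A. c (Inl i) *s b1 i) + (\<Sum>j\<in>B. c (Inr j) *s b2 j)" for c
    using fin by (simp add: sum.Plus b_def)
  have mod2: "(\<Sum>i\<in>A. c i *s b1 i) \<in> W2" for c
    using rel_basis_mem[OF b1] W by (intro subspace_sum subspace_scale) auto
  have inU: "(\<Sum>j\<in>B. c j *s b2 j) \<in> U" for c
    using rel_basis_mem[OF b2] U by (intro subspace_sum subspace_scale) auto
  have split: "\<exists>c. u - (\<Sum>j\<in>B. d j *s b2 j) - (\<Sum>i\<in>A. c i *s b1 i) \<in> W1"
    if "u \<in> U" "u - (\<Sum>j\<in>B. d j *s b2 j) \<in> W2" for u d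
    using that inU by (intro rel_basis_span[OF b1] IntI subspace_diff[OF U])
  have basis: "rel_basis U W1 (A <+> B) b"
    unfolding rel_basis_def
  proof (intro conjI ballI allI impI)
    show "finite (A <+> B)" using fin by simp
    show "b ` (A <+> B) \<subseteq> U"
      using rel_basis_mem[OF b1] rel_basis_mem[OF b2] by (auto simp: b_def)
  next
    fix u assume u: "u \<in> U"
    then obtain d where "u - (\<Sum>j\<in>B. d j *s b2 j) \<in> W2" using rel_basis_span[OF b2] by blast
    with u obtain c where "u - (\<Sum>j\<in>B. d j *s b2 j) - (\<Sum>i\<in>A. c i *s b1 i) \<in> W1"
      using split by blast
    then show "\<exists>c. u - (\<Sum>k\<in>A <+> B. c k *s b k) \<in> W1"
      unfolding sum_b by (intro exI[of _ "case_sum c d"]) (simp add: algebra_simps)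
  next
    fix c k assume c: "(\<Sum>k\<in>A <+> B. c k *s b k) \<in> W1" and k: "k \<in> A <+> B"
    have "(\<Sum>i\<in>A. c (Inl i) *s b1 i) + (\<Sum>j\<in>B. c (Inr j) *s b2 j) \<in> W2"
      using c W(3) unfolding sum_b by blast
    from subspace_diff[OF W(2) this mod2[of "\<lambda>i. c (Inl i)"]]
    have "(\<Sum>j\<in>B. c (Inr j) *s b2 j) \<in> W2" by simp
    then have B0: "c (Inr j) = 0" if "j \<in> B" for j
      using that by (rule rel_basis_independent[OF b2])
    then have "(\<Sum>i\<in>A. c (Inl i) *s b1 i) \<in> W1" using c unfolding sum_b by simp
    then have "c (Inl i) = 0" if "i \<in> A" for i
      using that by (rule rel_basis_independent[OF b1])
    then show "c k = 0" using k B0 by auto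
  qed
  have "\<forall>j\<in>B. \<exists>c. T (b2 j) - (\<Sum>l\<in>B. M2 j l *s b2 l) - (\<Sum>i\<in>A. c i *s b1 i) \<in> W1"
    using M2 T(4) rel_basis_mem[OF b2] by (intro ballI split) (auto simp: rel_matrix_def)
  then obtain N where N: "\<And>j. j \<in> B \<Longrightarrow>
      T (b2 j) - (\<Sum>l\<in>B. M2 j l *s b2 l) - (\<Sum>i\<in>A. N j i *s b1 i) \<in> W1" by metis
  define M where "M = case_sum (\<lambda>i. case_sum (M1 i) (\<lambda>_. 0)) (\<lambda>j. case_sum (N j) (M2 j))"
  have "rel_matrix W1 (A <+> B) b T M"
    unfolding rel_matrix_def sum_b
  proof
    fix k assume k: "k \<in> A <+> B"
    show "T (b k) - ((\<Sum>i\<in>A. M k (Inl i) *s b1 i) + (\<Sum>j\<in>B. M k (Inr j) *s b2 j)) \<in> W1"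
    proof (cases k)
      case (Inl i)
      then show ?thesis using k M1 by (auto simp: b_def M_def rel_matrix_def)
    next
      case (Inr j)
      then show ?thesis using k N[of j] by (auto simp: b_def M_def algebra_simps)
    qed
  qed
  from rel_trace_eq[OF W(1) T(1,2,4) basis this]
  have "rel_trace U W1 T = (\<Sum>k\<in>A <+> B. M k k)" .
  also have "\<dots> = (\<Sum>i\<in>A. M1 i i) + (\<Sum>j\<in>B. M2 j j)"
    using fin by (simp add: sum.Plus M_def)
  also have "(\<Sum>j\<in>B. M2 j j) = rel_trace U W2 T"
    by (rule rel_trace_eq[OF W(2) T(1,3,4) b2 M2, symmetric])
  also have "(\<Sum>i\<in>A. M1 i i) = rel_trace (U \<inter> W2) W1 T"
    using T by (intro rel_trace_eq[OF W(1) T(1,2) _ b1 M1, symmetric]) auto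
  finally show ?thesis .
qed

text \<open>
  The map \<open>\<phi>\<close> induces an isomorphism \<open>U / W \<rightarrow> U' / W'\<close> which intertwines \<open>T\<close> and \<open>T'\<close> up to
  the scalar \<open>r\<close>.
\<close>

lemma rel_trace_transfer:
  assumes W: "subspace W" "subspace W'"
    and T: "module_hom scale scale T" "\<And>w. w \<in> W \<Longrightarrow> T w \<in> W" "\<And>u. u \<in> U \<Longrightarrow> T u \<in> U"
    and T': "module_hom scale scale T'" "\<And>w. w \<in> W' \<Longrightarrow> T' w \<in> W'" "\<And>u. u \<in> U' \<Longrightarrow> T' u \<in> U'"
    and \<phi>: "module_hom scale scale \<phi>" "\<And>u. u \<in> U \<Longrightarrow> \<phi> u \<in> U'"
      "\<And>u. u \<in> U \<Longrightarrow> \<phi> u \<in> W' \<longleftrightarrow> u \<in> W"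
      "\<And>u'. u' \<in> U' \<Longrightarrow> \<exists>u\<in>U. u' - \<phi> u \<in> W'"
      "\<And>u. u \<in> U \<Longrightarrow> T' (\<phi> u) - r *s \<phi> (T u) \<in> W'"
    and U: "subspace U" and b: "rel_basis U W A b"
  shows "rel_basis U' W' A (\<phi> \<circ> b)" and "rel_trace U' W' T' = r * rel_trace U W T"
proof -
  obtain M where M: "rel_matrix W A b T M" using rel_matrix_exists[OF b T(3)] .
  have sum_\<phi>: "(\<Sum>i\<in>A. c i *s (\<phi> \<circ> b) i) = \<phi> (\<Sum>i\<in>A. c i *s b i)" for c
    by (simp add: module_hom.sum[OF \<phi>(1)] module_hom.scale[OF \<phi>(1)])
  have inU: "(\<Sum>i\<in>A. c i *s b i) \<in> U" for c
    using rel_basis_mem[OF b] U by (intro subspace_sum subspace_scale)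
  have \<phi>_diff: "\<phi> u - \<phi> (\<Sum>i\<in>A. c i *s b i) \<in> W' \<longleftrightarrow> u - (\<Sum>i\<in>A. c i *s b i) \<in> W"
    if "u \<in> U" for u c
    using \<phi>(3)[OF subspace_diff[OF U that inU]] by (simp add: module_hom.diff[OF \<phi>(1)])
  show basis: "rel_basis U' W' A (\<phi> \<circ> b)"
    unfolding rel_basis_def sum_\<phi>
  proof (intro conjI ballI allI impI)
    show "finite A" by (rule rel_basis_finite[OF b])
    show "(\<phi> \<circ> b) ` A \<subseteq> U'" using rel_basis_mem[OF b] \<phi>(2) by auto
  next
    fix u' assume "u' \<in> U'"
    then obtain u where u: "u \<in> U" "u' - \<phi> u \<in> W'" using \<phi>(4) by blast
    obtain c where "u - (\<Sum>i\<in>A. c i *s b i) \<in> W" using rel_basis_span[OF b u(1)] by blast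
    then have "\<phi> u - \<phi> (\<Sum>i\<in>A. c i *s b i) \<in> W'" using u(1) by (simp add: \<phi>_diff)
    then show "\<exists>c. u' - \<phi> (\<Sum>i\<in>A. c i *s b i) \<in> W'" using cong_mod_trans[OF W(2) u(2)] by blast
  next
    fix c i assume "\<phi> (\<Sum>i\<in>A. c i *s b i) \<in> W'" "i \<in> A"
    then show "c i = 0" using \<phi>(3)[OF inU] rel_basis_independent[OF b] by blast
  qed
  have "rel_matrix W' A (\<phi> \<circ> b) T' (\<lambda>i j. r * M i j)"
    unfolding rel_matrix_def
  proof
    fix i assume i: "i \<in> A"
    then have Tb: "T (b i) \<in> U" "b i \<in> U" using rel_basis_mem[OF b] T(3) by blast+
    have "T (b i) - (\<Sum>j\<in>A. M i j *s b j) \<in> W" using M i by (simp add: rel_matrix_def)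
    then have "\<phi> (T (b i)) - \<phi> (\<Sum>j\<in>A. M i j *s b j) \<in> W'" using Tb by (simp add: \<phi>_diff)
    from subspace_scale[OF W(2) this, of r]
    have "r *s \<phi> (T (b i)) - r *s \<phi> (\<Sum>j\<in>A. M i j *s b j) \<in> W'"
      by (simp add: scale_right_diff_distrib)
    from cong_mod_trans[OF W(2) \<phi>(5)[OF Tb(2)] this]
    show "T' ((\<phi> \<circ> b) i) - (\<Sum>j\<in>A. (r * M i j) *s (\<phi> \<circ> b) j) \<in> W'"
      by (simp add: sum_\<phi>[symmetric] scale_sum_right)
  qed
  from rel_trace_eq[OF W(2) T' basis this]
  have "rel_trace U' W' T' = (\<Sum>i\<in>A. r * M i i)" .
  also have "\<dots> = r * rel_trace U W T"
    by (simp add: rel_trace_eq[OF W(1) T b M] sum_distrib_left)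
  finally show "rel_trace U' W' T' = r * rel_trace U W T" .
qed

end

section \<open>The action of the symmetric group\<close>

definition perm_monom :: "'n::finite perm \<Rightarrow> ('n \<Rightarrow>\<^sub>0 nat) \<Rightarrow> ('n \<Rightarrow>\<^sub>0 nat)" where
  "perm_monom \<sigma> a = (\<Sum>i\<in>UNIV. Poly_Mapping.single (Perm.apply \<sigma> i) (Poly_Mapping.lookup a i))"

lemma apply_eq_iff: "Perm.apply \<sigma> i = j \<longleftrightarrow> i = Perm.apply (inverse \<sigma>) j"
  by (auto simp: apply_sequence)

lemma lookup_perm_monom:
  "Poly_Mapping.lookup (perm_monom \<sigma> a) j = Poly_Mapping.lookup a (Perm.apply (inverse \<sigma>) j)"
  by (simp add: perm_monom_def lookup_sum lookup_single when_def apply_eq_iff)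

lemma perm_monom_add: "perm_monom \<sigma> (a + b) = perm_monom \<sigma> a + perm_monom \<sigma> b"
  by (rule poly_mapping_eqI) (simp add: lookup_perm_monom lookup_add)

lemma perm_inverse_mult: "inverse (\<sigma> * \<tau>) = inverse \<tau> * inverse (\<sigma> :: 'n perm)"
  by (rule perm.inverse_distrib_swap)

lemma perm_monom_mult: "perm_monom \<sigma> (perm_monom \<tau> a) = perm_monom (\<sigma> * \<tau>) a"
  by (rule poly_mapping_eqI) (simp add: lookup_perm_monom perm_inverse_mult apply_times)

lemma perm_monom_one: "perm_monom 1 a = a"
  by (rule poly_mapping_eqI) (simp add: lookup_perm_monom)

lemma perm_monom_eq_iff: "perm_monom \<sigma> a = b \<longleftrightarrow> a = perm_monom (inverse \<sigma>) b"
  by (auto simp: perm_monom_mult perm_monom_one)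

lemma monom_degree_perm_monom: "monom_degree (perm_monom \<sigma> a) = monom_degree a"
  unfolding monom_degree_def lookup_perm_monom by (rule sum.reindex_bij_betw) simp

lemma Var_power: "Var i ^ k = Poly_Mapping.single (Poly_Mapping.single i k) 1"
  by (induction k) (simp_all add: Var_def mult_single flip: single_add)

lemma prod_single_one:
  "(\<Prod>i\<in>A. Poly_Mapping.single (m i) (1::'k::comm_ring_1)) = Poly_Mapping.single (sum m A) 1"
  by (induction A rule: infinite_finite_induct) (simp_all add: mult_single)

lemma poly_act_sum_single:
  "poly_act \<sigma> f = (\<Sum>a\<in>Poly_Mapping.keys f.
     Poly_Mapping.single (perm_monom \<sigma> a) (Poly_Mapping.lookup f a))"
  unfolding poly_act_def Var_power prod_single_one
  by (simp add: Const_def mult_single perm_monom_def)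

lemma lookup_poly_act:
  "Poly_Mapping.lookup (poly_act \<sigma> f) b = Poly_Mapping.lookup f (perm_monom (inverse \<sigma>) b)"
proof -
  have "Poly_Mapping.lookup (poly_act \<sigma> f) b = (\<Sum>a\<in>Poly_Mapping.keys f.
      if a = perm_monom (inverse \<sigma>) b then Poly_Mapping.lookup f a else 0)"
    unfolding poly_act_sum_single lookup_sum
    by (rule sum.cong) (auto simp: lookup_single when_def perm_monom_eq_iff)
  then show ?thesis by (simp add: in_keys_iff)
qed

lemma poly_act_add: "poly_act \<sigma> (f + g) = poly_act \<sigma> f + poly_act \<sigma> g"
  by (rule poly_mapping_eqI) (simp add: lookup_poly_act lookup_add)

lemma poly_act_Const_mult: "poly_act \<sigma> (Const a * f) = Const a * poly_act \<sigma> f"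
  by (rule poly_mapping_eqI) (simp add: lookup_poly_act lookup_Const_mult)

lemma poly_act_zero: "poly_act \<sigma> 0 = 0"
  by (rule poly_mapping_eqI) (simp add: lookup_poly_act)

lemma poly_act_sum: "poly_act \<sigma> (sum f A) = (\<Sum>x\<in>A. poly_act \<sigma> (f x))"
  by (induction A rule: infinite_finite_induct) (simp_all add: poly_act_add poly_act_zero)

lemma poly_act_one: "poly_act 1 f = f"
  by (rule poly_mapping_eqI) (simp add: lookup_poly_act perm_monom_one)

lemma poly_act_act: "poly_act \<sigma> (poly_act \<tau> f) = poly_act (\<sigma> * \<tau>) f"
  by (rule poly_mapping_eqI) (simp add: lookup_poly_act perm_monom_mult perm_inverse_mult)

lemma poly_act_single:
  "poly_act \<sigma> (Poly_Mapping.single a c) = Poly_Mapping.single (perm_monom \<sigma> a) c"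
  by (rule poly_mapping_eqI)
    (auto simp: lookup_poly_act lookup_single when_def perm_monom_mult perm_monom_one)

lemma poly_act_mult: "poly_act \<sigma> (f * g) = poly_act \<sigma> f * poly_act \<sigma> g"
proof -
  let ?m = "\<lambda>f a. Poly_Mapping.single a (Poly_Mapping.lookup f a)"
  have "poly_act \<sigma> ((\<Sum>a\<in>Poly_Mapping.keys f. ?m f a) * (\<Sum>b\<in>Poly_Mapping.keys g. ?m g b)) =
      poly_act \<sigma> (\<Sum>a\<in>Poly_Mapping.keys f. ?m f a) * poly_act \<sigma> (\<Sum>b\<in>Poly_Mapping.keys g. ?m g b)"
    unfolding sum_product poly_act_sum
    by (simp add: mult_single poly_act_single perm_monom_add)
  then show ?thesis by (simp flip: poly_mapping_sum_single)
qed

lemma poly_act_homogeneous: "f \<in> homogeneous_part e \<Longrightarrow> poly_act \<sigma> f \<in> homogeneous_part e"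
  by (simp add: mem_homogeneous_part_iff lookup_poly_act monom_degree_perm_monom)

lemma finite_perm: "finite (UNIV :: 'n::finite perm set)"
proof (rule finite_imageD)
  show "finite (range (Perm.apply :: 'n perm \<Rightarrow> 'n \<Rightarrow> 'n))" by simp
  show "inj (Perm.apply :: 'n perm \<Rightarrow> 'n \<Rightarrow> 'n)" by (simp add: inj_def Perm.apply_inject)
qed

section \<open>Graded traces of quotients of the polynomial ring\<close>

interpretation poly_space: subquotients "\<lambda>a (f :: ('n, 'k::field) mpoly). Const a * f"
  by unfold_locales (simp_all add: Const_add Const_mult Const_one algebra_simps)

abbreviation poly_linear :: "(('n, 'k::field) mpoly \<Rightarrow> ('n, 'k) mpoly) \<Rightarrow> bool" where
  "poly_linear \<equiv> module_hom (\<lambda>a f. Const a * f) (\<lambda>a f. Const a * f)"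

lemma poly_space_module: "module (\<lambda>a (f :: ('n, 'k::field) mpoly). Const a * f)"
  by unfold_locales (simp_all add: Const_add Const_mult Const_one algebra_simps)

lemma poly_linear_poly_act: "poly_linear (poly_act \<sigma>)"
  by (intro module_hom.intro poly_space_module module_hom_axioms.intro)
    (simp_all add: poly_act_add poly_act_Const_mult)

lemma poly_linear_mult: "poly_linear (\<lambda>x. g * x)"
  by (intro module_hom.intro poly_space_module module_hom_axioms.intro)
    (simp_all add: algebra_simps)

lemma subspace_ring_ideal: "ring_ideal J \<Longrightarrow> poly_space.subspace J"
  unfolding poly_space.subspace_def
  by (auto intro: ring_ideal_zero ring_ideal_add ring_ideal_mult)

lemma subspace_homogeneous_part: "poly_space.subspace (homogeneous_part e)"
  by (simp add: poly_space.subspace_def homogeneous_part_zero homogeneous_part_add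
      homogeneous_part_scale)

lemma finite_monom_degree_eq: "finite {a :: 'n::finite \<Rightarrow>\<^sub>0 nat. monom_degree a = e}"
proof (rule finite_imageD)
  have "Poly_Mapping.lookup a i \<le> monom_degree a" for a :: "'n \<Rightarrow>\<^sub>0 nat" and i
    unfolding monom_degree_def by (rule member_le_sum) auto
  then have "Poly_Mapping.lookup ` {a :: 'n \<Rightarrow>\<^sub>0 nat. monom_degree a = e} \<subseteq> (\<Pi>\<^sub>E i\<in>UNIV. {..e})"
    by (auto simp: PiE_def Pi_def)
  then show "finite (Poly_Mapping.lookup ` {a :: 'n \<Rightarrow>\<^sub>0 nat. monom_degree a = e})"
    by (rule finite_subset) (simp add: finite_PiE)
  show "inj_on Poly_Mapping.lookup {a :: 'n \<Rightarrow>\<^sub>0 nat. monom_degree a = e}"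
    by (rule inj_onI) (metis poly_mapping_eqI)
qed

lemma homogeneous_basis_exists:
  fixes W :: "('n::finite, 'k::field) mpoly set"
  assumes "poly_space.subspace W"
  obtains n :: nat and b where "poly_space.rel_basis (homogeneous_part e) W {..<n} b"
proof -
  let ?S = "(\<lambda>a. Poly_Mapping.single a 1) ` {a. monom_degree a = e} :: ('n, 'k) mpoly set"
  have "f \<in> poly_space.span ?S" if f: "f \<in> homogeneous_part e" for f :: "('n, 'k) mpoly"
  proof -
    have "(\<Sum>a\<in>Poly_Mapping.keys f. Const (Poly_Mapping.lookup f a) * Poly_Mapping.single a 1)
        \<in> poly_space.span ?S"
      using f by (intro poly_space.span_sum poly_space.span_scale poly_space.span_base)
        (auto simp: homogeneous_part_def)
    then show ?thesis
      by (simp add: Const_def mult_single flip: poly_mapping_sum_single)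
  qed
  moreover have "?S \<subseteq> homogeneous_part e" by (auto simp: homogeneous_part_def)
  moreover have "finite ?S" using finite_monom_degree_eq by (rule finite_imageI)
  ultimately show ?thesis
    using that poly_space.rel_basis_exists[OF assms, of ?S "homogeneous_part e"] by blast
qed

definition graded_trace ::
    "('n::finite, 'k::field) mpoly set \<Rightarrow> 'n perm \<Rightarrow> nat \<Rightarrow> 'k" where
  "graded_trace J \<sigma> e = poly_space.rel_trace (homogeneous_part e) J (poly_act \<sigma>)"

text \<open>
  Multiplication by \<open>g\<close> identifies the degree \<open>e - D\<close> part of \<open>R / J\<close>, twisted by the
  scalar \<open>r\<close> by which \<open>\<sigma>\<close> acts on \<open>g\<close>, with the degree \<open>e\<close> part of \<open>(J + (g)) / J\<close>.
\<close>

lemma graded_trace_nonzerodivisor: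
  fixes J J' :: "('n::finite, 'k::field) mpoly set"
  assumes J: "graded_ideal J" "\<And>f. f \<in> J \<Longrightarrow> poly_act \<sigma> f \<in> J"
    and J': "ring_ideal J'" "\<And>f. f \<in> J' \<Longrightarrow> poly_act \<sigma> f \<in> J'"
    and g: "g \<in> homogeneous_part D" "poly_act \<sigma> g = Const r * g"
    and nzd: "\<And>x. x * g \<in> J \<Longrightarrow> x \<in> J"
    and JJ': "J \<subseteq> J'" "g \<in> J'" "\<And>y. y \<in> J' \<Longrightarrow> \<exists>x. y - x * g \<in> J"
  shows "graded_trace J \<sigma> e =
    (if D \<le> e then r * graded_trace J \<sigma> (e - D) else 0) + graded_trace J' \<sigma> e"
proof -
  have ideal: "ring_ideal J" and J_hom: "\<And>f k. f \<in> J \<Longrightarrow> hom_part k f \<in> J"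
    using J(1) by (auto simp: graded_ideal_def)
  note sub = subspace_ring_ideal[OF ideal] subspace_ring_ideal[OF J'(1)]
  let ?R = "\<lambda>e. homogeneous_part e :: ('n, 'k) mpoly set"
  have act: "poly_act \<sigma> u \<in> ?R e" if "u \<in> ?R e" for u e
    using that by (rule poly_act_homogeneous)
  \<comment> \<open>as \<open>J\<close> is homogeneous, forms of degree \<open>e\<close> in \<open>J'\<close> are multiples of \<open>g\<close> by forms, modulo \<open>J\<close>\<close>
  have mult: "\<exists>x. u - hom_part (int e - int D) x * g \<in> J" if u: "u \<in> ?R e \<inter> J'" for u
  proof -
    obtain x where "u - x * g \<in> J" using JJ'(3) u by blast
    from J_hom[OF this, of "int e"] have "u - hom_part (int e - int D) x * g \<in> J"
      using u hom_part_homogeneous[of u e "int e"]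
      by (simp add: hom_part_diff hom_part_mult[OF g(1)])
    then show ?thesis by blast
  qed
  have act': "poly_act \<sigma> u \<in> ?R e \<inter> J'" if "u \<in> ?R e \<inter> J'" for u
    using that act J'(2) by blast
  obtain n2 :: nat and b2 where b2: "poly_space.rel_basis (?R e) J' {..<n2} b2"
    using homogeneous_basis_exists[OF sub(2)] .
  have additive: "graded_trace J \<sigma> e =
      poly_space.rel_trace (?R e \<inter> J') J (poly_act \<sigma>) + graded_trace J' \<sigma> e"
    if b1: "poly_space.rel_basis (?R e \<inter> J') J A b1" for A :: "nat set" and b1
    unfolding graded_trace_def
    by (rule poly_space.rel_trace_additive[OF subspace_homogeneous_part sub JJ'(1)
        poly_linear_poly_act J(2) J'(2) act b1 b2])
  show ?thesis
  proof (cases "D \<le> e")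
    case True
    obtain n1 :: nat and b1 where b1: "poly_space.rel_basis (?R (e - D)) J {..<n1} b1"
      using homogeneous_basis_exists[OF sub(1)] .
    have in_J': "g * u \<in> ?R e \<inter> J'" if "u \<in> ?R (e - D)" for u
      using homogeneous_part_mult[OF g(1) that] ring_ideal_mult[OF J'(1) JJ'(2), of u] True
      by (simp add: mult.commute)
    have iff: "g * u \<in> J \<longleftrightarrow> u \<in> J" for u
      using nzd[of u] ring_ideal_mult[OF ideal, of u g] by (auto simp: mult.commute)
    have surj: "\<exists>u\<in>?R (e - D). u' - g * u \<in> J" if u': "u' \<in> ?R e \<inter> J'" for u'
    proof -
      obtain x where "u' - hom_part (int e - int D) x * g \<in> J" using mult[OF u'] by blast
      moreover have "hom_part (int e - int D) x \<in> ?R (e - D)"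
        using hom_part_mem[of "e - D" x] True by (simp add: of_nat_diff)
      ultimately show ?thesis by (auto simp: mult.commute)
    qed
    have twist: "poly_act \<sigma> (g * u) - Const r * (g * poly_act \<sigma> u) \<in> J" for u
      by (simp add: poly_act_mult g(2) mult.assoc ring_ideal_zero[OF ideal])
    note transfer = poly_space.rel_trace_transfer[OF sub(1) sub(1) poly_linear_poly_act J(2) act
        poly_linear_poly_act J(2) act' poly_linear_mult in_J' iff surj twist
        subspace_homogeneous_part b1]
    have "poly_space.rel_basis (?R e \<inter> J') J {..<n1} ((*) g \<circ> b1)"
      by (rule transfer(1))
    moreover have "poly_space.rel_trace (?R e \<inter> J') J (poly_act \<sigma>) = r * graded_trace J \<sigma> (e - D)"
      unfolding graded_trace_def by (rule transfer(2))
    ultimately show ?thesis using additive True by simp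
  next
    case False
    then have "u \<in> J" if "u \<in> ?R e \<inter> J'" for u
      using mult[OF that] by (simp add: hom_part_negative)
    then have empty: "poly_space.rel_basis (?R e \<inter> J') J {} (\<lambda>_::nat. 0)"
      by (simp add: poly_space.rel_basis_def)
    have "poly_space.rel_matrix J {} (\<lambda>_::nat. 0) (poly_act \<sigma>) (\<lambda>_ _. 0)"
      by (simp add: poly_space.rel_matrix_def)
    from poly_space.rel_trace_eq[OF sub(1) poly_linear_poly_act J(2) act' empty this]
    have "poly_space.rel_trace (?R e \<inter> J') J (poly_act \<sigma>) = 0" by simp
    then show ?thesis using additive[OF empty] False by simp
  qed
qed

text \<open>The action of \<open>\<tau>\<close> is an automorphism of \<open>R / J\<close> that carries \<open>\<sigma>\<close> to its conjugate.\<close>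

lemma graded_trace_conjugate:
  fixes J :: "('n::finite, 'k::field) mpoly set"
  assumes J: "ring_ideal J" "sym_stable J"
  shows "graded_trace J (\<tau> * \<sigma> * inverse \<tau>) e = graded_trace J \<sigma> e"
proof -
  let ?R = "homogeneous_part e :: ('n, 'k) mpoly set"
  note sub = subspace_ring_ideal[OF J(1)]
  have stable: "poly_act \<rho> f \<in> J" if "f \<in> J" for \<rho> f using J(2) that by (simp add: sym_stable_def)
  have act: "poly_act \<rho> u \<in> ?R" if "u \<in> ?R" for \<rho> u using that by (rule poly_act_homogeneous)
  obtain n :: nat and b where b: "poly_space.rel_basis ?R J {..<n} b"
    using homogeneous_basis_exists[OF sub] .
  have iff: "poly_act \<tau> u \<in> J \<longleftrightarrow> u \<in> J" for u
    using stable[of "poly_act \<tau> u" "inverse \<tau>"] stable[of u \<tau>]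
    by (auto simp: poly_act_act poly_act_one)
  have surj: "\<exists>u\<in>?R. u' - poly_act \<tau> u \<in> J" if "u' \<in> ?R" for u'
    using act[OF that, of "inverse \<tau>"]
    by (intro bexI[of _ "poly_act (inverse \<tau>) u'"])
      (simp_all add: poly_act_act poly_act_one ring_ideal_zero[OF J(1)])
  have twist: "poly_act (\<tau> * \<sigma> * inverse \<tau>) (poly_act \<tau> u) - Const 1 * poly_act \<tau> (poly_act \<sigma> u) \<in> J"
    for u
    by (simp add: poly_act_act mult.assoc Const_one ring_ideal_zero[OF J(1)])
  show ?thesis
    using poly_space.rel_trace_transfer(2)[OF sub sub poly_linear_poly_act stable act
        poly_linear_poly_act stable act poly_linear_poly_act act iff surj twist
        subspace_homogeneous_part b]
    by (simp add: graded_trace_def)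
qed

section \<open>Characters of graded representations as graded traces\<close>

text \<open>
  A representation \<open>V\<close> presented as a quotient of \<open>R\<close> by a subspace \<open>W\<close> through a projection
  \<open>\<pi>\<close>.  Both \<open>R\<close> itself and its quotients by ideals are of this form.
\<close>

locale poly_projection =
  fixes V :: "('n::finite, 'k::field, 'v) graded_rep" and \<pi> :: "('n, 'k) mpoly \<Rightarrow> 'v"
    and W :: "('n, 'k) mpoly set"
  assumes subspace: "poly_space.subspace W"
    and stable: "f \<in> W \<Longrightarrow> poly_act \<sigma> f \<in> W"
    and proj_add: "\<pi> (u + v) = rep_add V (\<pi> u) (\<pi> v)"
    and proj_zero: "\<pi> 0 = rep_zero V"
    and proj_scale: "\<pi> (Const a * u) = rep_scale V a (\<pi> u)"
    and proj_act: "\<pi> (poly_act \<sigma> u) = rep_act V \<sigma> (\<pi> u)"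
    and proj_eq_iff: "\<pi> u = \<pi> v \<longleftrightarrow> u - v \<in> W"
begin

lemma lincomb_proj:
  "length as = length vs \<Longrightarrow>
    lincomb V as (map \<pi> vs) = \<pi> (\<Sum>i<length vs. Const (as ! i) * vs ! i)"
proof (induction as vs rule: list_induct2)
  case Nil
  then show ?case by (simp add: lincomb_def proj_zero)
next
  case (Cons a as v vs)
  have "(\<Sum>i<length (v # vs). Const ((a # as) ! i) * (v # vs) ! i) =
      Const a * v + (\<Sum>i<length vs. Const (as ! i) * vs ! i)"
    by (simp add: sum.lessThan_Suc_shift del: sum.lessThan_Suc)
  then show ?case using Cons by (simp add: lincomb_def proj_add proj_scale)
qed

lemma is_basis_proj_iff:
  assumes U: "poly_space.subspace U" and vs: "set vs \<subseteq> U"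
  shows "is_basis V (\<pi> ` U) (map \<pi> vs) \<longleftrightarrow> poly_space.rel_basis U W {..<length vs} ((!) vs)"
    (is "?L \<longleftrightarrow> ?R")
proof
  assume L: ?L
  have ex1: "\<exists>!as. length as = length vs \<and> lincomb V as (map \<pi> vs) = \<pi> u" if "u \<in> U" for u
    using L that by (simp add: is_basis_def)
  show ?R
    unfolding poly_space.rel_basis_def
  proof (intro conjI ballI allI impI)
    show "(!) vs ` {..<length vs} \<subseteq> U" using vs by auto
  next
    fix u assume "u \<in> U"
    then obtain as where "length as = length vs" "lincomb V as (map \<pi> vs) = \<pi> u"
      using ex1 by blast
    then have "\<pi> u = \<pi> (\<Sum>i<length vs. Const (as ! i) * vs ! i)" by (simp add: lincomb_proj)
    then show "\<exists>c. u - (\<Sum>i<length vs. Const (c i) * vs ! i) \<in> W"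
      unfolding proj_eq_iff by (rule exI[of _ "(!) as"])
  next
    fix c i assume c: "(\<Sum>i<length vs. Const (c i) * vs ! i) \<in> W" and i: "i \<in> {..<length vs}"
    let ?as = "map c [0..<length vs]" and ?zs = "replicate (length vs) 0"
    have "(\<Sum>i<length vs. Const (?as ! i) * vs ! i) = (\<Sum>i<length vs. Const (c i) * vs ! i)"
      by (rule sum.cong) auto
    then have "lincomb V ?as (map \<pi> vs) = \<pi> 0"
      using c by (simp add: lincomb_proj proj_eq_iff)
    moreover have "(\<Sum>i<length vs. Const (?zs ! i) * vs ! i) = 0"
      by (rule sum.neutral) (simp add: Const_zero)
    then have "lincomb V ?zs (map \<pi> vs) = \<pi> 0" by (simp add: lincomb_proj)
    ultimately have "?as = ?zs" using ex1[OF poly_space.subspace_0[OF U]] by auto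
    then have "?as ! i = ?zs ! i" by simp
    then show "c i = 0" using i by simp
  qed simp
next
  assume R: ?R
  show ?L
    unfolding is_basis_def
  proof (intro conjI ballI)
    show "set (map \<pi> vs) \<subseteq> \<pi> ` U" using vs by auto
  next
    fix v assume "v \<in> \<pi> ` U"
    then obtain u where u: "v = \<pi> u" "u \<in> U" by blast
    obtain c where c: "u - (\<Sum>i<length vs. Const (c i) * vs ! i) \<in> W"
      using poly_space.rel_basis_span[OF R u(2)] by blast
    have "(\<Sum>i<length vs. Const (map c [0..<length vs] ! i) * vs ! i) =
        (\<Sum>i<length vs. Const (c i) * vs ! i)"
      by (rule sum.cong) auto
    with lincomb_proj[of "map c [0..<length vs]" vs]
    have "lincomb V (map c [0..<length vs]) (map \<pi> vs) =
        \<pi> (\<Sum>i<length vs. Const (c i) * vs ! i)" by simp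
    then have "lincomb V (map c [0..<length vs]) (map \<pi> vs) = v"
      using proj_eq_iff[THEN iffD2, OF c] u(1) by simp
    moreover have "as = bs" if as: "length as = length vs" "lincomb V as (map \<pi> vs) = v"
      and bs: "length bs = length vs" "lincomb V bs (map \<pi> vs) = v" for as bs
    proof (rule nth_equalityI)
      fix i assume "i < length as"
      moreover have "u - (\<Sum>i<length vs. Const (as ! i) * vs ! i) \<in> W"
        using as u(1) by (simp add: lincomb_proj flip: proj_eq_iff)
      moreover have "u - (\<Sum>i<length vs. Const (bs ! i) * vs ! i) \<in> W"
        using bs u(1) by (simp add: lincomb_proj flip: proj_eq_iff)
      ultimately show "as ! i = bs ! i"
        using as(1) poly_space.rel_basis_unique[OF subspace R] by simp
    qed (use as bs in simp)
    ultimately show "\<exists>!as. length as = length (map \<pi> vs) \<and> lincomb V as (map \<pi> vs) = v"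
      by (intro ex1I[of _ "map c [0..<length vs]"]) auto
  qed
qed

text \<open>
  Whichever basis of \<open>V\<close> the definition of the trace selects, it lifts to a relative basis in \<open>R\<close>
  with the same matrix.
\<close>

lemma trace_on_proj: "trace_on V (\<pi> ` homogeneous_part e) (rep_act V \<sigma>) = graded_trace W \<sigma> e"
proof -
  let ?U = "homogeneous_part e :: ('n, 'k) mpoly set"
  obtain n :: nat and b where b: "poly_space.rel_basis ?U W {..<n} b"
    using homogeneous_basis_exists[OF subspace] .
  have "poly_space.rel_basis ?U W {..<n} ((!) (map b [0..<n]))"
    using b by (simp add: poly_space.rel_basis_def image_def cong: sum.cong_simp)
  then have "is_basis V (\<pi> ` ?U) (map \<pi> (map b [0..<n]))"
    using poly_space.rel_basis_mem[OF b]
    by (subst is_basis_proj_iff[OF subspace_homogeneous_part]) auto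
  then have "is_basis V (\<pi> ` ?U) (SOME bs. is_basis V (\<pi> ` ?U) bs)" by (rule someI)
  moreover define bs where "bs = (SOME bs. is_basis V (\<pi> ` ?U) bs)"
  ultimately have basis: "is_basis V (\<pi> ` ?U) bs" by simp
  define vs where "vs = map (inv_into ?U \<pi>) bs"
  have "set bs \<subseteq> \<pi> ` ?U" using basis by (simp add: is_basis_def)
  then have vs: "set vs \<subseteq> ?U" and bs: "bs = map \<pi> vs"
    unfolding vs_def by (auto simp: inv_into_into f_inv_into_f subset_iff o_def intro: map_idI[symmetric])
  then have rel: "poly_space.rel_basis ?U W {..<length vs} ((!) vs)"
    using basis is_basis_proj_iff[OF subspace_homogeneous_part vs] by (simp add: bs)
  define M where "M i = (!) (coords V bs (\<pi> (poly_act \<sigma> (vs ! i))))" for i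
  have "poly_space.rel_matrix W {..<length vs} ((!) vs) (poly_act \<sigma>) M"
    unfolding poly_space.rel_matrix_def
  proof
    fix i assume "i \<in> {..<length vs}"
    then have "poly_act \<sigma> (vs ! i) \<in> ?U" using vs by (intro poly_act_homogeneous) auto
    then have "\<exists>!as. length as = length bs \<and> lincomb V as bs = \<pi> (poly_act \<sigma> (vs ! i))"
      using basis by (simp add: is_basis_def)
    from theI'[OF this] have "lincomb V (coords V bs (\<pi> (poly_act \<sigma> (vs ! i)))) (map \<pi> vs) =
        \<pi> (poly_act \<sigma> (vs ! i))" and "length (coords V bs (\<pi> (poly_act \<sigma> (vs ! i)))) = length vs"
      unfolding coords_def by (simp_all add: bs)
    then show "poly_act \<sigma> (vs ! i) - (\<Sum>j<length vs. Const (M i j) * vs ! j) \<in> W"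
      by (simp add: lincomb_proj M_def flip: proj_eq_iff)
  qed
  from poly_space.rel_trace_eq[OF subspace poly_linear_poly_act stable poly_act_homogeneous rel this]
  have "graded_trace W \<sigma> e = (\<Sum>i<length vs. M i i)" by (simp add: graded_trace_def)
  also have "\<dots> = trace_on V (\<pi> ` ?U) (rep_act V \<sigma>)"
    by (simp add: trace_on_def M_def bs proj_act flip: bs_def)
  finally show ?thesis by simp
qed

end

lemma rep_coset_poly_rep: "rep_coset poly_rep J u = (+) u ` J"
  by (simp add: rep_coset_def poly_rep_def)

lemma coset_eq_iff:
  assumes J: "ring_ideal (J :: 'a::comm_ring_1 set)"
  shows "(+) u ` J = (+) v ` J \<longleftrightarrow> u - v \<in> J"
proof
  assume eq: "(+) u ` J = (+) v ` J"
  have "u + 0 \<in> (+) u ` J" using ring_ideal_zero[OF J] by blast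
  then show "u - v \<in> J" using eq by auto
next
  have sub: "(+) u ` J \<subseteq> (+) v ` J" if "u - v \<in> J" for u v
  proof
    fix x assume "x \<in> (+) u ` J"
    then obtain y where "y \<in> J" "x = v + (u - v + y)" by auto
    then show "x \<in> (+) v ` J" using ring_ideal_add[OF J that] by blast
  qed
  assume uv: "u - v \<in> J"
  then have "v - u \<in> J" using ring_ideal_neg[OF J uv] by simp
  with uv show "(+) u ` J = (+) v ` J" using sub by blast
qed

lemma coset_add:
  assumes J: "ring_ideal (J :: 'a::comm_ring_1 set)"
  shows "(+) (u + v) ` J = {x + y | x y. x \<in> (+) u ` J \<and> y \<in> (+) v ` J}"
proof safe
  fix z assume "z \<in> J"
  then show "\<exists>x y. u + v + z = x + y \<and> x \<in> (+) u ` J \<and> y \<in> (+) v ` J"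
    using ring_ideal_zero[OF J]
    by (intro exI[of _ "u + z"] exI[of _ "v + 0"] conjI imageI) (simp_all add: algebra_simps)
next
  fix y z assume yz: "y \<in> J" "z \<in> J"
  have "u + y + (v + z) = u + v + (y + z)" by (simp add: algebra_simps)
  then show "u + y + (v + z) \<in> (+) (u + v) ` J" using ring_ideal_add[OF J yz] by simp
qed

lemma coset_scale:
  assumes J: "ring_ideal (J :: ('n, 'k::field) mpoly set)"
  shows "(+) (Const a * u) ` J = (\<Union>v\<in>(+) u ` J. (+) (Const a * v) ` J)"
proof -
  have same: "(+) (Const a * v) ` J = (+) (Const a * u) ` J" if v: "v \<in> (+) u ` J" for v
  proof -
    obtain y where "y \<in> J" "v = u + y" using v by blast
    then have "Const a * v - Const a * u \<in> J"
      using ring_ideal_mult[OF J] by (simp add: distrib_left)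
    then show ?thesis by (simp add: coset_eq_iff[OF J])
  qed
  have "u + 0 \<in> (+) u ` J" using ring_ideal_zero[OF J] by blast
  then have "(+) u ` J \<noteq> {}" by blast
  then show ?thesis by (simp add: same)
qed

lemma coset_poly_act:
  assumes J: "sym_stable J"
  shows "(+) (poly_act \<sigma> u) ` J = poly_act \<sigma> ` (+) u ` J"
proof -
  have "poly_act \<sigma> ` J = J"
  proof safe
    fix f assume "f \<in> J"
    then have "f = poly_act \<sigma> (poly_act (inverse \<sigma>) f)" "poly_act (inverse \<sigma>) f \<in> J"
      using J by (simp_all add: sym_stable_def poly_act_act poly_act_one)
    then show "f \<in> poly_act \<sigma> ` J" by blast
  qed (use J in \<open>simp add: sym_stable_def\<close>)
  moreover have "poly_act \<sigma> ` (+) u ` J = (+) (poly_act \<sigma> u) ` poly_act \<sigma> ` J"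
    by (simp add: image_image poly_act_add)
  ultimately show ?thesis by simp
qed

lemma poly_projection_quotient:
  assumes J: "ring_ideal J" "sym_stable J"
  shows "poly_projection (quotient_rep poly_rep J) (\<lambda>u. (+) u ` J) J"
proof
  show "(+) 0 ` J = rep_zero (quotient_rep poly_rep J)"
    by (simp add: quotient_rep_def)
  show "(+) (Const a * u) ` J = rep_scale (quotient_rep poly_rep J) a ((+) u ` J)" for a u
  proof -
    have scale: "rep_scale (quotient_rep poly_rep J) a A = (\<Union>v\<in>A. (+) (Const a * v) ` J)" for A
      by (simp add: quotient_rep_def rep_coset_poly_rep) (simp add: poly_rep_def)
    show ?thesis unfolding scale by (rule coset_scale[OF J(1)])
  qed
  show "(+) (u + v) ` J = rep_add (quotient_rep poly_rep J) ((+) u ` J) ((+) v ` J)" for u v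
    unfolding coset_add[OF J(1)] by (simp add: quotient_rep_def poly_rep_def)
  show "(+) (poly_act \<sigma> u) ` J = rep_act (quotient_rep poly_rep J) \<sigma> ((+) u ` J)" for \<sigma> u
    unfolding coset_poly_act[OF J(2)] by (simp add: quotient_rep_def poly_rep_def)
qed (use J in \<open>simp_all add: subspace_ring_ideal coset_eq_iff sym_stable_def\<close>)

lemma poly_projection_poly_rep: "poly_projection poly_rep (\<lambda>u. u) {0}"
  by unfold_locales (simp_all add: poly_rep_def poly_act_zero)

definition graded_trace_char ::
    "('n::finite, 'k::field) mpoly set \<Rightarrow> nat \<Rightarrow> ('n, 'k) class_fun" where
  "graded_trace_char J e = Class_fun (\<lambda>\<sigma>. graded_trace J \<sigma> e)"

lemma graded_trace_char_apply:
  assumes "ring_ideal J" "sym_stable J"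
  shows "class_fun_apply (graded_trace_char J e) \<sigma> = graded_trace J \<sigma> e"
  unfolding graded_trace_char_def
  by (subst Class_fun_inverse) (simp_all add: graded_trace_conjugate[OF assms])

lemma graded_character_quotient_rep:
  assumes "ring_ideal J" "sym_stable J"
  shows "graded_character (quotient_rep poly_rep J) = Abs_fps (graded_trace_char J)"
proof -
  have "rep_component (quotient_rep poly_rep J) e = (\<lambda>u. (+) u ` J) ` homogeneous_part e" for e
    by (simp add: quotient_rep_def rep_coset_def) (simp add: poly_rep_def)
  then have "character (quotient_rep poly_rep J) = graded_trace_char J"
    using poly_projection.trace_on_proj[OF poly_projection_quotient[OF assms]]
    by (simp add: fun_eq_iff character_def graded_trace_char_def)
  then show ?thesis by (simp add: graded_character_def)
qed

lemma graded_character_poly_rep: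
  "graded_character (poly_rep :: ('n::finite, 'k::field, ('n, 'k) mpoly) graded_rep) =
    Abs_fps (graded_trace_char {0})"
proof -
  have "rep_component poly_rep e = (\<lambda>u. u) ` (homogeneous_part e :: ('n, 'k) mpoly set)"
    for e by (simp add: poly_rep_def)
  then have "character poly_rep = (graded_trace_char {0} :: nat \<Rightarrow> ('n, 'k) class_fun)"
    by (simp only: fun_eq_iff character_def graded_trace_char_def
        poly_projection.trace_on_proj[OF poly_projection_poly_rep] simp_thms)
  then show ?thesis by (simp add: graded_character_def)
qed

section \<open>Semi-invariant lifts of a basis of \<open>I / \<mm> I\<close>\<close>

lemma class_fun_eqI: "(\<And>\<sigma>. class_fun_apply a \<sigma> = class_fun_apply b \<sigma>) \<Longrightarrow> a = b"
  by (simp add: class_fun_apply_inject[symmetric] fun_eq_iff)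

lemma trivial_char_apply: "class_fun_apply trivial_char \<sigma> = 1"
  by (simp add: trivial_char.rep_eq)

definition multiplicative_char :: "('n::finite, 'k::field) class_fun \<Rightarrow> bool" where
  "multiplicative_char \<chi> \<longleftrightarrow> class_fun_apply \<chi> 1 = 1
     \<and> (\<forall>\<sigma> \<tau>. class_fun_apply \<chi> (\<sigma> * \<tau>) = class_fun_apply \<chi> \<sigma> * class_fun_apply \<chi> \<tau>)"

lemma multiplicative_trivial_char: "multiplicative_char trivial_char"
  by (simp add: multiplicative_char_def trivial_char_apply)

lemma multiplicative_alternating_char:
  "multiplicative_char (alternating_char :: ('n::finite, 'k::field) class_fun)"
proof -
  have "permutation (Perm.apply \<rho>)" for \<rho> :: "'n perm"
    using Perm.apply[of \<rho>] by (simp add: permutation)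
  then show ?thesis
    by (simp add: multiplicative_char_def alternating_char.rep_eq times_perm.rep_eq sign_compose
        one_perm.rep_eq sign_id)
qed

text \<open>
  Averaging \<open>\<chi>(\<sigma>\<^sup>-\<^sup>1) \<sigma> u\<close> over the group, which is where characteristic zero is needed, does not
  change the class of \<open>u\<close> modulo \<open>N\<close>.
\<close>

lemma semi_invariant_lift:
  fixes J N :: "('n::finite, 'k::field_char_0) mpoly set"
  assumes J: "ring_ideal J" "sym_stable J" and N: "ring_ideal N"
    and \<chi>: "multiplicative_char \<chi>"
    and u: "u \<in> J" "u \<in> homogeneous_part e"
      "\<And>\<sigma>. poly_act \<sigma> u - Const (class_fun_apply \<chi> \<sigma>) * u \<in> N"
  obtains f where "f \<in> J" "f \<in> homogeneous_part e" "f - u \<in> N"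
    "\<And>\<sigma>. poly_act \<sigma> f = Const (class_fun_apply \<chi> \<sigma>) * f"
proof
  let ?c = "class_fun_apply \<chi>"
  have c_mult: "?c (\<sigma> * \<tau>) = ?c \<sigma> * ?c \<tau>" and c_one: "?c 1 = 1" for \<sigma> \<tau>
    using \<chi> by (auto simp: multiplicative_char_def)
  have c_inverse: "?c (inverse \<sigma>) * ?c \<sigma> = 1" for \<sigma>
    by (simp add: c_one flip: c_mult)
  define n where "n = card (UNIV :: 'n perm set)"
  have n: "of_nat n \<noteq> (0::'k)" using finite_perm[where 'n = 'n] by (simp add: n_def)
  define w where "w \<sigma> = ?c (inverse \<sigma>) / of_nat n" for \<sigma>
  define f where "f = (\<Sum>\<sigma>\<in>UNIV. Const (w \<sigma>) * poly_act \<sigma> u)"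
  show "f \<in> J"
    unfolding f_def using J u(1)
    by (intro ring_ideal_sum ring_ideal_mult) (auto simp: sym_stable_def)
  show "f \<in> homogeneous_part e"
    unfolding f_def using u(2)
    by (intro homogeneous_part_sum homogeneous_part_scale poly_act_homogeneous)
  have "w \<sigma> * ?c \<sigma> = 1 / of_nat n" for \<sigma> by (simp add: w_def c_inverse)
  then have "(\<Sum>\<sigma>\<in>UNIV. Const (w \<sigma>) * (Const (?c \<sigma>) * u)) =
      (\<Sum>\<sigma>\<in>(UNIV :: 'n perm set). Const (1 / of_nat n) * u)"
    by (simp add: mult.assoc[symmetric] Const_mult[symmetric])
  also have "\<dots> = (\<Sum>\<sigma>\<in>(UNIV :: 'n perm set). Const (1 / of_nat n)) * u"
    by (rule sum_distrib_right[symmetric])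
  also have "(\<Sum>\<sigma>\<in>(UNIV :: 'n perm set). Const (1 / of_nat n)) = (1 :: ('n, 'k) mpoly)"
    unfolding Const_sum[symmetric] using n by (simp add: Const_one n_def)
  finally have "f - u = (\<Sum>\<sigma>\<in>UNIV. Const (w \<sigma>) * (poly_act \<sigma> u - Const (?c \<sigma>) * u))"
    by (simp add: f_def right_diff_distrib sum_subtractf)
  also have "\<dots> \<in> N" using N u(3) by (intro ring_ideal_sum ring_ideal_mult)
  finally show "f - u \<in> N" .
  show "poly_act \<tau> f = Const (?c \<tau>) * f" for \<tau>
  proof -
    have "poly_act \<tau> f = (\<Sum>\<sigma>\<in>UNIV. Const (w \<sigma>) * poly_act (\<tau> * \<sigma>) u)"
      by (simp add: f_def poly_act_sum poly_act_Const_mult poly_act_act)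
    also have "\<dots> = (\<Sum>\<sigma>\<in>UNIV. Const (?c \<tau>) * Const (w (\<tau> * \<sigma>)) * poly_act (\<tau> * \<sigma>) u)"
    proof (rule sum.cong[OF refl])
      fix \<sigma> :: "'n perm"
      have "?c \<tau> * w (\<tau> * \<sigma>) = w \<sigma>"
        using c_inverse[of \<tau>] by (simp add: w_def perm_inverse_mult c_mult mult_ac)
      then show "Const (w \<sigma>) * poly_act (\<tau> * \<sigma>) u =
          Const (?c \<tau>) * Const (w (\<tau> * \<sigma>)) * poly_act (\<tau> * \<sigma>) u"
        by (simp flip: Const_mult)
    qed
    also have "\<dots> = (\<Sum>\<sigma>\<in>UNIV. Const (?c \<tau>) * Const (w \<sigma>) * poly_act \<sigma> u)"
    proof (rule sum.reindex_bij_betw)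
      show "bij ((*) \<tau>)"
        by (rule bij_betw_byWitness[of _ "\<lambda>\<rho>. inverse \<tau> * \<rho>"])
          (simp_all add: mult.assoc[symmetric])
    qed
    also have "\<dots> = Const (?c \<tau>) * f"
      by (simp add: f_def sum_distrib_left mult.assoc)
    finally show ?thesis .
  qed
qed

text \<open>
  The summands of \<open>I / \<mm> I\<close> are numbered from 0, the alternating one coming first; their
  degrees are \<open>d, c 1, \<dots>, c m\<close>, that is \<open>case_nat d (\<lambda>j. c (Suc j)) i\<close>.
\<close>

definition generator_char :: "nat \<Rightarrow> ('n, 'k::comm_ring_1) class_fun" where
  "generator_char i = (if i = 0 then alternating_char else trivial_char)"

lemma multiplicative_generator_char: "multiplicative_char (generator_char i)"
  by (simp add: generator_char_def multiplicative_alternating_char multiplicative_trivial_char)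

text \<open>The group permutes the variables, so it preserves \<open>\<mm>\<close> and with it \<open>\<mm> J\<close>.\<close>

lemma sym_stable_ideal_mult_max_ideal:
  fixes J :: "('n::finite, 'k::comm_ring_1) mpoly set"
  assumes J: "ring_ideal J" "sym_stable J"
  shows "sym_stable (ideal_mult max_ideal J)"
  unfolding sym_stable_def
proof (intro allI ballI)
  fix \<sigma> :: "'n perm" and x assume "x \<in> ideal_mult max_ideal J"
  then obtain b where b: "\<forall>v. b v \<in> J" "x = (\<Sum>v\<in>UNIV. Var v * b v)"
    by (rule ideal_mult_max_idealE[OF J(1)]) blast
  have "perm_monom \<sigma> (Poly_Mapping.single v 1) = Poly_Mapping.single (Perm.apply \<sigma> v) 1" for v
    by (rule poly_mapping_eqI) (auto simp: lookup_perm_monom lookup_single when_def apply_eq_iff)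
  then have "poly_act \<sigma> (Var v) = (Var (Perm.apply \<sigma> v) :: ('n, 'k) mpoly)" for v
    by (simp add: Var_def poly_act_single)
  then have "poly_act \<sigma> (Var v) \<in> (max_ideal :: ('n, 'k) mpoly set)" for v
    by (simp add: max_ideal_def ideal_gen_base)
  then show "poly_act \<sigma> x \<in> ideal_mult max_ideal J"
    using b(1) J(2) unfolding b(2) poly_act_sum poly_act_mult
    by (intro ring_ideal_sum[OF ring_ideal_ideal_mult] ideal_mult_base) (auto simp: sym_stable_def)
qed

text \<open>
  The isomorphism in coordinates: \<open>\<psi> u i\<close> is the coordinate of the class of \<open>u\<close> in the \<open>i\<close>-th
  summand.  Since the isomorphism is graded, the coordinate vectors have homogeneous lifts.
\<close>

lemma generator_space_coordinates:
  fixes I :: "('n::finite, 'k::field) mpoly set"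
  assumes I: "ring_ideal I" "sym_stable I"
    and iso: "graded_rep_iso (quotient_rep (subrep poly_rep I) (ideal_mult max_ideal I))
      (sum_rep (alternating_rep d) (direct_sum_rep {1..m} (\<lambda>i. trivial_rep (c i))))"
  obtains \<psi> :: "('n, 'k) mpoly \<Rightarrow> nat \<Rightarrow> 'k"
  where "\<And>u v i. u \<in> I \<Longrightarrow> v \<in> I \<Longrightarrow> i \<le> m \<Longrightarrow> \<psi> (u + v) i = \<psi> u i + \<psi> v i"
    and "\<And>a u i. u \<in> I \<Longrightarrow> i \<le> m \<Longrightarrow> \<psi> (Const a * u) i = a * \<psi> u i"
    and "\<And>\<sigma> u i. u \<in> I \<Longrightarrow> i \<le> m \<Longrightarrow>
      \<psi> (poly_act \<sigma> u) i = class_fun_apply (generator_char i) \<sigma> * \<psi> u i"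
    and "\<And>u v. u \<in> I \<Longrightarrow> v \<in> I \<Longrightarrow>
      u - v \<in> ideal_mult max_ideal I \<longleftrightarrow> (\<forall>i\<le>m. \<psi> u i = \<psi> v i)"
    and "\<And>i. i \<le> m \<Longrightarrow> \<exists>u\<in>I \<inter> homogeneous_part (case_nat d (\<lambda>j. c (Suc j)) i).
      \<forall>j\<le>m. \<psi> u j = (if j = i then 1 else 0)"
proof -
  let ?N = "ideal_mult max_ideal I"
  let ?Q = "quotient_rep (subrep poly_rep I) ?N"
  let ?S = "sum_rep (alternating_rep d) (direct_sum_rep {1..m} (\<lambda>i. trivial_rep (c i)))
    :: ('n, 'k, 'k \<times> (nat \<Rightarrow> 'k)) graded_rep"
  note N = ring_ideal_ideal_mult[of max_ideal I]
  note stable = sym_stable_ideal_mult_max_ideal[OF I]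
  define \<pi> where "\<pi> u = (+) u ` ?N" for u
  have coset: "rep_coset (subrep poly_rep I) ?N = \<pi>"
    by (rule ext) (simp add: rep_coset_def subrep_def poly_rep_def \<pi>_def)
  have space: "rep_space ?Q = \<pi> ` I" and component: "rep_component ?Q e = \<pi> ` (homogeneous_part e \<inter> I)"
    and add: "rep_add ?Q (\<pi> u) (\<pi> v) = \<pi> (u + v)" and act: "rep_act ?Q \<sigma> (\<pi> u) = \<pi> (poly_act \<sigma> u)"
    for e u v \<sigma>
    unfolding quotient_rep_def coset
    by (simp_all add: subrep_def poly_rep_def \<pi>_def coset_add[OF N] coset_poly_act[OF stable])
  have scale: "rep_scale ?Q a (\<pi> u) = \<pi> (Const a * u)" for a u
  proof -
    have "rep_scale ?Q a (\<pi> u) = (\<Union>v\<in>(+) u ` ?N. (+) (Const a * v) ` ?N)"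
      unfolding quotient_rep_def coset by (simp add: subrep_def poly_rep_def \<pi>_def)
    then show ?thesis unfolding \<pi>_def coset_scale[OF N, symmetric] .
  qed
  obtain \<phi> where bij: "bij_betw \<phi> (rep_space ?Q) (rep_space ?S)"
    and \<phi>_add: "\<And>A B. A \<in> rep_space ?Q \<Longrightarrow> B \<in> rep_space ?Q \<Longrightarrow>
      \<phi> (rep_add ?Q A B) = rep_add ?S (\<phi> A) (\<phi> B)"
    and \<phi>_scale: "\<And>a A. A \<in> rep_space ?Q \<Longrightarrow> \<phi> (rep_scale ?Q a A) = rep_scale ?S a (\<phi> A)"
    and \<phi>_act: "\<And>\<sigma> A. A \<in> rep_space ?Q \<Longrightarrow> \<phi> (rep_act ?Q \<sigma> A) = rep_act ?S \<sigma> (\<phi> A)"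
    and \<phi>_component: "\<And>e. \<phi> ` rep_component ?Q e = rep_component ?S e"
    using iso unfolding graded_rep_iso_def by auto
  define \<psi> where "\<psi> u i = (if i = 0 then fst (\<phi> (\<pi> u)) else snd (\<phi> (\<pi> u)) i)" for u i
  note S_simps = sum_rep_def direct_sum_rep_def alternating_rep_def trivial_rep_def one_dim_rep_def
  have mem: "\<pi> u \<in> rep_space ?Q" if "u \<in> I" for u using that space by blast
  have ext: "snd (\<phi> (\<pi> u)) \<in> extensional {1..m}" if "u \<in> I" for u
  proof -
    have "\<phi> (\<pi> u) \<in> rep_space ?S" using bij mem[OF that] by (rule bij_betwE[THEN bspec])
    then show ?thesis by (auto simp: S_simps PiE_def)
  qed
  show ?thesis
  proof (rule that)
    fix u v i assume "u \<in> I" "v \<in> I" "i \<le> m"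
    then show "\<psi> (u + v) i = \<psi> u i + \<psi> v i"
      using \<phi>_add[OF mem mem, of u v] unfolding add
      by (simp add: \<psi>_def S_simps split: prod.splits)
  next
    fix a u i assume "u \<in> I" "i \<le> m"
    then show "\<psi> (Const a * u) i = a * \<psi> u i"
      using \<phi>_scale[OF mem, of u a] unfolding scale
      by (simp add: \<psi>_def S_simps split: prod.splits)
  next
    fix \<sigma> u i assume "u \<in> I" "i \<le> m"
    then show "\<psi> (poly_act \<sigma> u) i = class_fun_apply (generator_char i) \<sigma> * \<psi> u i"
      using \<phi>_act[OF mem, of u \<sigma>] unfolding act
      by (simp add: \<psi>_def S_simps generator_char_def split: prod.splits)
  next
    fix u v assume uv: "u \<in> I" "v \<in> I"
    have "u - v \<in> ?N \<longleftrightarrow> \<pi> u = \<pi> v" by (simp add: \<pi>_def coset_eq_iff[OF N])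
    also have "\<dots> \<longleftrightarrow> \<phi> (\<pi> u) = \<phi> (\<pi> v)"
      using bij mem uv by (auto simp: bij_betw_def dest: inj_onD)
    also have "\<dots> \<longleftrightarrow> (\<forall>i\<le>m. \<psi> u i = \<psi> v i)"
    proof
      assume eq: "\<forall>i\<le>m. \<psi> u i = \<psi> v i"
      have "fst (\<phi> (\<pi> u)) = fst (\<phi> (\<pi> v))" using eq[rule_format, of 0] by (simp add: \<psi>_def)
      moreover have "snd (\<phi> (\<pi> u)) = snd (\<phi> (\<pi> v))"
        using eq by (intro extensionalityI[OF ext ext] uv) (auto simp: \<psi>_def split: if_splits)
      ultimately show "\<phi> (\<pi> u) = \<phi> (\<pi> v)" by (rule prod_eqI)
    qed (simp add: \<psi>_def)
    finally show "u - v \<in> ?N \<longleftrightarrow> (\<forall>i\<le>m. \<psi> u i = \<psi> v i)" .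
  next
    fix i assume i: "i \<le> m"
    let ?D = "case_nat d (\<lambda>j. c (Suc j)) i"
    let ?e = "(if i = 0 then 1 else 0, \<lambda>j\<in>{1..m}. if j = i then 1 else 0) :: 'k \<times> (nat \<Rightarrow> 'k)"
    have "?e \<in> rep_component ?S ?D"
      using i by (auto simp: S_simps PiE_def split: nat.splits)
    then obtain u where u: "u \<in> homogeneous_part ?D \<inter> I" "\<phi> (\<pi> u) = ?e"
      unfolding \<phi>_component[symmetric] component by auto
    have "\<forall>j\<le>m. \<psi> u j = (if j = i then 1 else 0)"
      unfolding \<psi>_def u(2) by auto
    then show "\<exists>u\<in>I \<inter> homogeneous_part ?D. \<forall>j\<le>m. \<psi> u j = (if j = i then 1 else 0)"
      using u(1) by blast
  qed
qed

lemma semi_invariant_minimal_generators: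
  fixes I :: "('n::finite, 'k::field_char_0) mpoly set"
  assumes I: "ring_ideal I" "sym_stable I"
    and iso: "graded_rep_iso (quotient_rep (subrep poly_rep I) (ideal_mult max_ideal I))
      (sum_rep (alternating_rep d) (direct_sum_rep {1..m} (\<lambda>i. trivial_rep (c i))))"
  obtains f where "minimal_generators I (Suc m) (case_nat d (\<lambda>j. c (Suc j))) f"
    and "\<And>i \<sigma>. i \<le> m \<Longrightarrow> poly_act \<sigma> (f i) = Const (class_fun_apply (generator_char i) \<sigma>) * f i"
proof -
  let ?N = "ideal_mult max_ideal I" and ?D = "case_nat d (\<lambda>j. c (Suc j))"
  obtain \<psi> :: "('n, 'k) mpoly \<Rightarrow> nat \<Rightarrow> 'k"
    where \<psi>_add: "\<And>u v i. u \<in> I \<Longrightarrow> v \<in> I \<Longrightarrow> i \<le> m \<Longrightarrow> \<psi> (u + v) i = \<psi> u i + \<psi> v i"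
    and \<psi>_scale: "\<And>a u i. u \<in> I \<Longrightarrow> i \<le> m \<Longrightarrow> \<psi> (Const a * u) i = a * \<psi> u i"
    and \<psi>_act: "\<And>\<sigma> u i. u \<in> I \<Longrightarrow> i \<le> m \<Longrightarrow>
      \<psi> (poly_act \<sigma> u) i = class_fun_apply (generator_char i) \<sigma> * \<psi> u i"
    and \<psi>_iff: "\<And>u v. u \<in> I \<Longrightarrow> v \<in> I \<Longrightarrow> u - v \<in> ?N \<longleftrightarrow> (\<forall>i\<le>m. \<psi> u i = \<psi> v i)"
    and \<psi>_unit: "\<And>i. i \<le> m \<Longrightarrow> \<exists>u\<in>I \<inter> homogeneous_part (?D i).
      \<forall>j\<le>m. \<psi> u j = (if j = i then 1 else 0)"
    by (rule generator_space_coordinates[OF I iso]) blast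
  define lift where "lift i f \<longleftrightarrow> f \<in> I \<and> f \<in> homogeneous_part (?D i)
      \<and> (\<forall>j\<le>m. \<psi> f j = (if j = i then 1 else 0))
      \<and> (\<forall>\<sigma>. poly_act \<sigma> f = Const (class_fun_apply (generator_char i) \<sigma>) * f)" for i f
  have "\<exists>f. lift i f" if i: "i \<le> m" for i
  proof -
    obtain u where u: "u \<in> I" "u \<in> homogeneous_part (?D i)"
      and unit: "\<And>j. j \<le> m \<Longrightarrow> \<psi> u j = (if j = i then 1 else 0)"
      using \<psi>_unit[OF i] by blast
    have act: "poly_act \<sigma> u \<in> I" for \<sigma> using I(2) u(1) by (simp add: sym_stable_def)
    have scale: "Const a * u \<in> I" for a using I(1) u(1) by (rule ring_ideal_mult)
    have "poly_act \<sigma> u - Const (class_fun_apply (generator_char i) \<sigma>) * u \<in> ?N" for \<sigma>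
      using u(1) by (simp add: \<psi>_iff[OF act scale] \<psi>_act \<psi>_scale unit)
    from semi_invariant_lift[OF I ring_ideal_ideal_mult multiplicative_generator_char u this]
    obtain f where f: "f \<in> I" "f \<in> homogeneous_part (?D i)" "f - u \<in> ?N"
      "\<And>\<sigma>. poly_act \<sigma> f = Const (class_fun_apply (generator_char i) \<sigma>) * f" by metis
    then show ?thesis using \<psi>_iff[OF f(1) u(1)] unit
      unfolding lift_def by (intro exI[of _ f]) simp
  qed
  then obtain f where "\<And>i. i \<le> m \<Longrightarrow> lift i (f i)" by metis
  then have f: "\<And>i. i \<le> m \<Longrightarrow> f i \<in> I" "\<And>i. i \<le> m \<Longrightarrow> f i \<in> homogeneous_part (?D i)"
    and unit: "\<And>i j. i \<le> m \<Longrightarrow> j \<le> m \<Longrightarrow> \<psi> (f i) j = (if j = i then 1 else 0)"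
    and semi: "\<And>i \<sigma>. i \<le> m \<Longrightarrow>
      poly_act \<sigma> (f i) = Const (class_fun_apply (generator_char i) \<sigma>) * f i"
    unfolding lift_def by blast+
  let ?sum = "\<lambda>l. \<Sum>i<Suc m. Const (l i) * f i"
  have \<psi>_zero: "\<psi> 0 j = 0" if "j \<le> m" for j
    using \<psi>_scale[OF ring_ideal_zero[OF I(1)] that, of 0] by (simp add: Const_zero)
  have sum_mem: "?sum l \<in> I" for l
    using I(1) f(1) by (intro ring_ideal_sum ring_ideal_mult) auto
  have \<psi>_sum: "\<psi> (?sum l) j = l j" if j: "j \<le> m" for l j
  proof -
    have "(\<Sum>i\<in>A. Const (l i) * f i) \<in> I \<and>
        \<psi> (\<Sum>i\<in>A. Const (l i) * f i) j = (\<Sum>i\<in>A. l i * \<psi> (f i) j)"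
      if "finite A" "A \<subseteq> {..<Suc m}" for A
      using that
    proof (induction A rule: finite_induct)
      case empty
      then show ?case using j by (simp add: \<psi>_zero ring_ideal_zero[OF I(1)])
    next
      case (insert i A)
      then have i: "f i \<in> I" using f(1) by auto
      then have "Const (l i) * f i \<in> I" by (rule ring_ideal_mult[OF I(1)])
      then show ?case
        using insert i j by (simp add: \<psi>_add \<psi>_scale ring_ideal_add[OF I(1)])
    qed
    then have "\<psi> (?sum l) j = (\<Sum>i<Suc m. l i * \<psi> (f i) j)" by blast
    also have "\<dots> = (\<Sum>i<Suc m. if i = j then l i else 0)"
      using unit j by (intro sum.cong refl) auto
    finally show ?thesis using j by simp
  qed
  have "minimal_generators I (Suc m) ?D f"
    unfolding minimal_generators_def
  proof (intro conjI allI ballI impI)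
    fix i assume "i < Suc m"
    then show "f i \<in> I" "f i \<in> homogeneous_part (?D i)" using f by auto
  next
    fix g assume "g \<in> I"
    then have "g - ?sum (\<psi> g) \<in> ?N" by (simp add: \<psi>_iff[OF _ sum_mem] \<psi>_sum del: sum.lessThan_Suc)
    then show "\<exists>l. g - ?sum l \<in> ?N" by (rule exI[of _ "\<psi> g"])
  next
    fix l i assume "?sum l \<in> ?N" "i < Suc m"
    then have "?sum l - 0 \<in> ?N" by simp
    then have "\<forall>i\<le>m. \<psi> (?sum l) i = \<psi> 0 i"
      unfolding \<psi>_iff[OF sum_mem ring_ideal_zero[OF I(1)]] .
    then have "\<psi> (?sum l) i = \<psi> 0 i" using \<open>i < Suc m\<close> by (simp del: sum.lessThan_Suc)
    then show "l i = 0" using \<open>i < Suc m\<close> by (simp add: \<psi>_sum \<psi>_zero del: sum.lessThan_Suc)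
  qed
  then show ?thesis using semi by (rule that)
qed

section \<open>The graded character of the quotient\<close>

lemma sym_stable_ideal_gen_semi_invariant:
  fixes f :: "nat \<Rightarrow> ('n::finite, 'k::comm_ring_1) mpoly"
  assumes "\<And>i \<sigma>. i < n \<Longrightarrow> poly_act \<sigma> (f i) = Const (r \<sigma> i) * f i"
  shows "sym_stable (ideal_gen (f ` {..<n}))"
  unfolding sym_stable_def
proof (intro allI ballI)
  fix \<sigma> :: "'n perm" and x assume "x \<in> ideal_gen (f ` {..<n})"
  then obtain a where "x = (\<Sum>i<n. a i * f i)" unfolding mem_ideal_gen_image_lessThan by blast
  then have "poly_act \<sigma> x = (\<Sum>i<n. (poly_act \<sigma> (a i) * Const (r \<sigma> i)) * f i)"
    using assms by (simp add: poly_act_sum poly_act_mult mult.assoc)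
  then show "poly_act \<sigma> x \<in> ideal_gen (f ` {..<n})"
    unfolding mem_ideal_gen_image_lessThan by (rule exI[of _ "\<lambda>i. poly_act \<sigma> (a i) * Const (r \<sigma> i)"])
qed

text \<open>
  Each further element \<open>f\<^sub>n\<close> contributes the exact sequence
  \<open>0 \<rightarrow> R/I\<^sub>n (- D n) \<otimes> \<chi> n \<rightarrow> R/I\<^sub>n \<rightarrow> R/I\<^bsub>n+1\<^esub> \<rightarrow> 0\<close> and hence one factor of the product.
\<close>

lemma graded_trace_char_product:
  fixes f :: "nat \<Rightarrow> ('n::finite, 'k::field) mpoly" and \<chi> :: "nat \<Rightarrow> ('n, 'k) class_fun"
  assumes "nonzerodivisor_chain n f"
    and "\<And>i. i < n \<Longrightarrow> f i \<in> homogeneous_part (D i)"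
    and "\<And>i \<sigma>. i < n \<Longrightarrow> poly_act \<sigma> (f i) = Const (class_fun_apply (\<chi> i) \<sigma>) * f i"
  shows "Abs_fps (graded_trace_char (ideal_gen (f ` {..<n}))) =
    Abs_fps (graded_trace_char {0}) * (\<Prod>i<n. 1 - fps_const (\<chi> i) * fps_X ^ D i)"
  using assms
proof (induction n)
  case 0
  have "ideal_gen {} = {0 :: ('n, 'k) mpoly}"
    by (simp add: ideal_gen_def module.span_empty[OF module_self])
  then show ?case by simp
next
  case (Suc n)
  define J where "J = (\<lambda>n. ideal_gen (f ` {..<n}))"
  have graded: "graded_ideal (J k)" if k: "k \<le> Suc n" for k
    unfolding J_def
  proof (rule graded_ideal_ideal_gen, safe)
    fix i assume "i < k"
    then have "f i \<in> homogeneous_part (D i)" using k by (intro Suc.prems(2)) simp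
    then show "f i \<in> (\<Union>e. homogeneous_part e)" by blast
  qed
  have ideal: "ring_ideal (J k)" for k
    unfolding J_def by (rule ring_ideal_ideal_gen)
  have stable: "sym_stable (J k)" if "k \<le> Suc n" for k
    unfolding J_def using that Suc.prems(3)
    by (intro sym_stable_ideal_gen_semi_invariant[where r = "\<lambda>\<sigma> i. class_fun_apply (\<chi> i) \<sigma>"]) simp
  have step: "graded_trace (J n) \<sigma> e =
      (if D n \<le> e then class_fun_apply (\<chi> n) \<sigma> * graded_trace (J n) \<sigma> (e - D n) else 0)
      + graded_trace (J (Suc n)) \<sigma> e" for \<sigma> e
  proof (rule graded_trace_nonzerodivisor[where g = "f n"])
    show "x \<in> J n" if "x * f n \<in> J n" for x
      using that Suc.prems(1) by (simp add: J_def nonzerodivisor_chain_def)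
    show "J n \<subseteq> J (Suc n)"
      unfolding J_def by (intro ideal_gen_subset ring_ideal_ideal_gen) (auto intro: ideal_gen_base)
    show "f n \<in> J (Suc n)" unfolding J_def by (rule ideal_gen_base) simp
    show "\<exists>x. y - x * f n \<in> J n" if y: "y \<in> J (Suc n)" for y
    proof -
      obtain a where "y = (\<Sum>i<Suc n. a i * f i)"
        using y unfolding J_def mem_ideal_gen_image_lessThan by blast
      then have "y - a n * f n = (\<Sum>i<n. a i * f i)" by simp
      then have "y - a n * f n \<in> J n" unfolding J_def mem_ideal_gen_image_lessThan by (rule exI[of _ a])
      then show ?thesis by (rule exI)
    qed
  qed (use graded[of n] ideal stable[of n] stable[of "Suc n"] Suc.prems(2,3) in
      \<open>auto simp: sym_stable_def\<close>)
  have coeff: "graded_trace_char (J (Suc n)) e = graded_trace_char (J n) e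
      - (if e < D n then 0 else \<chi> n * graded_trace_char (J n) (e - D n))" for e
  proof (rule class_fun_eqI)
    fix \<sigma>
    note apply_char = graded_trace_char_apply[OF ideal stable]
    show "class_fun_apply (graded_trace_char (J (Suc n)) e) \<sigma> =
      class_fun_apply (graded_trace_char (J n) e
        - (if e < D n then 0 else \<chi> n * graded_trace_char (J n) (e - D n))) \<sigma>"
      using step[of \<sigma> e]
      by (simp add: minus_class_fun.rep_eq times_class_fun.rep_eq zero_class_fun.rep_eq apply_char
          split: if_splits)
  qed
  have "Abs_fps (graded_trace_char (J (Suc n))) =
      Abs_fps (graded_trace_char (J n)) * (1 - fps_const (\<chi> n) * fps_X ^ D n)"
  proof (rule fps_ext)
    fix e
    have "Abs_fps (graded_trace_char (J n)) * (1 - fps_const (\<chi> n) * fps_X ^ D n) =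
        Abs_fps (graded_trace_char (J n)) - fps_const (\<chi> n) * (Abs_fps (graded_trace_char (J n)) * fps_X ^ D n)"
      by (simp add: algebra_simps)
    then show "fps_nth (Abs_fps (graded_trace_char (J (Suc n)))) e =
        fps_nth (Abs_fps (graded_trace_char (J n)) * (1 - fps_const (\<chi> n) * fps_X ^ D n)) e"
      by (simp add: coeff fps_X_power_mult_right_nth)
  qed
  moreover have "Abs_fps (graded_trace_char (J n)) =
      Abs_fps (graded_trace_char {0}) * (\<Prod>i<n. 1 - fps_const (\<chi> i) * fps_X ^ D i)"
    unfolding J_def using Suc.prems
    by (intro Suc.IH) (simp_all add: nonzerodivisor_chain_def)
  ultimately show ?case by (simp add: J_def mult.assoc)
qed

theorem theorem3p4:
  fixes I :: "('n::finite, 'k::field_char_0) mpoly set"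
    and d m :: nat
    and c :: "nat \<Rightarrow> nat"
  assumes "homogeneous_ideal I"
    and "sym_stable I"
    and "complete_intersection_ideal I"
    and "graded_rep_iso
           (quotient_rep (subrep poly_rep I) (ideal_mult max_ideal I))
           (sum_rep (alternating_rep d) (direct_sum_rep {1..m} (\<lambda>i. trivial_rep (c i))))"
  shows "graded_character (quotient_rep poly_rep I) =
           graded_character poly_rep
           * (fps_const trivial_char - fps_const alternating_char * fps_X ^ d)
           * (\<Prod>i = 1..m. 1 - fps_X ^ c i)"
proof -
  have graded: "graded_ideal I"
    using assms(1) graded_ideal_ideal_gen by (auto simp: homogeneous_ideal_def)
  then have ideal: "ring_ideal I" by (simp add: graded_ideal_def)
  let ?D = "case_nat d (\<lambda>j. c (Suc j))"
  obtain f where f: "minimal_generators I (Suc m) ?D f"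
    and semi: "\<And>i \<sigma>. i \<le> m \<Longrightarrow>
      poly_act \<sigma> (f i) = Const (class_fun_apply (generator_char i) \<sigma>) * f i"
    using semi_invariant_minimal_generators[OF ideal assms(2,4)] by blast
  have one: "trivial_char = (1 :: ('n, 'k) class_fun)"
    by (rule class_fun_eqI) (simp add: trivial_char_apply one_class_fun.rep_eq)
  have "graded_character (quotient_rep poly_rep I) =
      Abs_fps (graded_trace_char (ideal_gen (f ` {..<Suc m})))"
    unfolding minimal_generators_generate[OF graded f]
    by (rule graded_character_quotient_rep[OF ideal assms(2)])
  also have "\<dots> = Abs_fps (graded_trace_char {0})
      * (\<Prod>i<Suc m. 1 - fps_const (generator_char i) * fps_X ^ ?D i)"
    by (rule graded_trace_char_product[OF
          minimal_generators_nonzerodivisor_chain[OF graded assms(3) f]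
          minimal_generators_homogeneous[OF f] semi]) simp_all
  also have "Abs_fps (graded_trace_char {0}) =
      graded_character (poly_rep :: ('n, 'k, ('n, 'k) mpoly) graded_rep)"
    by (rule graded_character_poly_rep[symmetric])
  also have "(\<Prod>i<Suc m. 1 - fps_const (generator_char i :: ('n, 'k) class_fun) * fps_X ^ ?D i) =
      (fps_const trivial_char - fps_const alternating_char * fps_X ^ d)
      * (\<Prod>i = 1..m. 1 - fps_X ^ c i)"
    unfolding prod.lessThan_Suc_shift
    by (simp add: generator_char_def one prod.atLeast1_atMost_eq)
  finally show ?thesis by (simp only: mult.assoc)
qed

end
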